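(* Let the data $X,K,X_j,\gamma_j,A,Y,\varphi,j,f,R,q,a_S$ satisfy the standing assumptions listed in the context, and assume $\alpha_\varphi+\alpha_jc_j^2<m_A$. Let $T>0$, let $N$ be a positive integer and $k=T/N$. Then (without any restriction on the size of $k$) there is a unique $u^k=\{u_n^k\}_{n=0}^N\subset K$ such that for every $0\le n\le N$ and every $v\in K$, $$\langle Au_n^k,v-u_n^k\rangle+\varphi(\mathcal S_{n,L}^ku^k,u_n^k,v)-\varphi(\mathcal S_{n,L}^ku^k,u_n^k,u_n^k)+j^0(\gamma_ju_n^k;\gamma_jv-\gamma_ju_n^k)\ge\langle f_n,v-u_n^k\rangle.$$
   Context: Notation. All spaces are real. $\mathbb R_+=[0,\infty)$; $X^*,X_j^*$ are topological duals; $\langle\cdot,\cdot\rangle$ is the duality pairing between $X^*$ and $X$, $\langle\cdot,\cdot\rangle_{X_j}$ the one between $X_j^*$ and $X_j$; $\mathcal L(\cdot;\cdot)$ denotes bounded linear operators, $\mathcal L(X)=\mathcal L(X;X)$. For a locally Lipschitz $j:X_j\to\mathbb R$, the Clarke directional derivative is $j^0(x;v)=\limsup_{y\to x,\lambda\downarrow0}\frac{j(y+\lambda v)-j(y)}{\lambda}$ and $\partial j(x)=\{\xi\in X_j^*: j^0(x;v)\ge\langle\xi,v\rangle_{X_j}\ \forall v\in X_j\}$. Standing assumptions on the data. $X$ is a reflexive Banach space, $K\subset X$ is closed and convex, $0\in K$. $X_j$ is a Banach space, $\gamma_j\in\mathcal L(X;X_j)$ and $c_j>0$ satisfies $\|\gamma_jv\|_{X_j}\le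 c_j\|v\|_X$ for all $v\in X$. $A:X\to X^*$ is Lipschitz continuous with constant $L_A>0$ and strongly monotone: $\langle Av_1-Av_2,v_1-v_2\rangle\ge m_A\|v_1-v_2\|_X^2$ for all $v_1,v_2\in X$, with $m_A>0$. $Y$ is a normed space and $\varphi:Y\times K\times K\to\mathbb R$ is such that $\varphi(y,u,\cdot)$ is convex and lower semicontinuous on $K$ for all $y\in Y,u\in K$, and there are $\alpha_\varphi>0,\beta_\varphi>0$ with $\varphi(y_1,u_1,v_2)-\varphi(y_1,u_1,v_1)+\varphi(y_2,u_2,v_1)-\varphi(y_2,u_2,v_2)\le\alpha_\varphi\|u_1-u_2\|_X\|v_1-v_2\|_X+\beta_\varphi\|y_1-y_2\|_Y\|v_1-v_2\|_X$ for all $y_1,y_2\in Y$, $u_1,u_2,v_1,v_2\in K$. The function $j:X_j\to\mathbb R$ is locally Lipschitz; there are $c_0,c_1\ge0$ with $\|\xi\|_{X_j^*}\le c_0+c_1\|z\|_{X_j}$ for all $z\in X_j$, $\xi\in\partial j(z)$; there is $\alpha_j>0$ with $j^0(z_1;z_2-z_1)+j^0(z_2;z_1-z_2)\le\alpha_j\|z_1-z_2\|_{X_j}^2$ for all $z_1,z_2\in X_j$. $f\in C(\mathbb R_+;X^* )$. $R\in\mathcal L(X;Y)$, $q\in C(\mathbb R_+\times\mathbb R_+;\mathcal L(X))$, $a_S\in X$; these define the history-dependent operator $(\mathcal Sv)(t)=R\left(\int_0^tq(t,s)v(s)\,ds+a_S\right)$ for $v\in C(\mathbb R_+;X)$. Time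 discretization. $t_n=nk$, $0\le n\le N$, $f_n=f(t_n)$. For a sequence $v=\{v_n\}$ in $X$ and $n\ge1$, $\mathcal S_{n,L}^kv=R\left(\frac k2q(t_n,t_0)v_0+k\sum_{i=1}^{n-1}q(t_n,t_i)v_i+\frac k2q(t_n,t_{n-1})v_{n-1}+a_S\right)$ (empty sum $=0$), and $\mathcal S_{0,L}^kv=R\,a_S$. *)

theory Defs
  imports "HOL-Analysis.Analysis"
begin

type_synonym 'a dual = "'a \<Rightarrow>\<^sub>L real"

definition canonical_embedding :: "'a::real_normed_vector \<Rightarrow> 'a dual dual" where
  "canonical_embedding x = Blinfun (\<lambda>\<xi>. blinfun_apply \<xi> x)"

lemma canonical_embedding_apply: "canonical_embedding x \<xi> = \<xi> x"
  by (simp add: canonical_embedding_def bounded_linear_Blinfun_apply blinfun.bounded_linear_left)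

definition reflexive :: "'a::real_normed_vector itself \<Rightarrow> bool" where
  "reflexive _ \<longleftrightarrow> surj (canonical_embedding :: 'a \<Rightarrow> 'a dual dual)"

definition lower_semicontinuous_on :: "'a::topological_space set \<Rightarrow> ('a \<Rightarrow> real) \<Rightarrow> bool" where
  "lower_semicontinuous_on S f \<longleftrightarrow>
     (\<forall>x\<in>S. \<forall>c < f x. eventually (\<lambda>y. c < f y) (at x within S))"

definition locally_lipschitz :: "('a::metric_space \<Rightarrow> 'b::metric_space) \<Rightarrow> bool" where
  "locally_lipschitz f \<longleftrightarrow> (\<forall>x. \<exists>e>0. \<exists>L. L-lipschitz_on (ball x e) f)"

(* The filter lets y tend to x with y = x allowed. The Limsup is taken in ereal; it is finite
   for locally Lipschitz j (lemma ereal_clarke_deriv below), so real_of_ereal loses nothing. *)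
definition clarke_deriv :: "('a::real_normed_vector \<Rightarrow> real) \<Rightarrow> 'a \<Rightarrow> 'a \<Rightarrow> real" where
  "clarke_deriv j x v = real_of_ereal
     (Limsup (nhds x \<times>\<^sub>F at_right 0) (\<lambda>(y, l). ereal ((j (y + l *\<^sub>R v) - j y) / l)))"

definition clarke_subdiff :: "('a::real_normed_vector \<Rightarrow> real) \<Rightarrow> 'a \<Rightarrow> 'a dual set" where
  "clarke_subdiff j x = {\<xi>. \<forall>v. clarke_deriv j x v \<ge> blinfun_apply \<xi> v}"

lemma ereal_clarke_deriv:
  fixes j :: "'a::real_normed_vector \<Rightarrow> real"
  assumes "locally_lipschitz j"
  shows "ereal (clarke_deriv j x v) =
    Limsup (nhds x \<times>\<^sub>F at_right 0) (\<lambda>(y, l). ereal ((j (y + l *\<^sub>R v) - j y) / l))"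
proof -
  let ?F = "nhds x \<times>\<^sub>F at_right (0::real)"
  let ?q = "\<lambda>(y, l). ereal ((j (y + l *\<^sub>R v) - j y) / l)"
  from assms obtain e L where e: "e > 0" and L: "L-lipschitz_on (ball x e) j"
    unfolding locally_lipschitz_def by blast
  have nt: "?F \<noteq> bot"
    by (simp add: prod_filter_eq_bot)
  have fst: "(fst \<longlongrightarrow> x) ?F"
    by (rule filterlim_fst)
  have snd: "filterlim snd (at_right 0) ?F"
    by (rule filterlim_snd)
  then have snd': "(snd \<longlongrightarrow> 0) ?F"
    by (simp add: filterlim_at)
  have "((\<lambda>p. fst p + snd p *\<^sub>R v) \<longlongrightarrow> x + 0 *\<^sub>R v) ?F"
    by (intro tendsto_intros fst snd')
  then have "\<forall>\<^sub>F p in ?F. fst p + snd p *\<^sub>R v \<in> ball x e"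
    using e by (auto dest!: tendstoD simp: dist_commute)
  moreover have "\<forall>\<^sub>F p in ?F. fst p \<in> ball x e"
    using tendstoD[OF fst e] by (simp add: dist_commute)
  moreover have "\<forall>\<^sub>F p in ?F. snd p > 0"
    using snd by (auto simp: filterlim_at elim: eventually_mono)
  ultimately have ev: "\<forall>\<^sub>F p in ?F. \<bar>(j (fst p + snd p *\<^sub>R v) - j (fst p)) / snd p\<bar> \<le> L * norm v"
  proof eventually_elim
    case (elim p)
    have "\<bar>j (fst p + snd p *\<^sub>R v) - j (fst p)\<bar> \<le> L * (snd p * norm v)"
      using lipschitz_onD[OF L elim(1,2)] elim(3) by (simp add: dist_norm)
    with elim(3) show ?case
      by (simp add: field_simps)
  qed
  have "Limsup ?F ?q \<le> ereal (L * norm v)"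
    by (rule Limsup_bounded, use ev in eventually_elim)
      (simp add: case_prod_unfold abs_le_iff minus_le_iff del: abs_divide)
  moreover have "ereal (- (L * norm v)) \<le> Limsup ?F ?q"
    by (rule le_Limsup[OF nt], use ev in eventually_elim)
      (simp add: case_prod_unfold abs_le_iff minus_le_iff del: abs_divide)
  ultimately have "\<bar>Limsup ?F ?q\<bar> \<noteq> \<infinity>"
    by auto
  then show ?thesis
    unfolding clarke_deriv_def by (simp add: ereal_real')
qed

(* The discretized operator S_{n,L}^k on the uniform grid t_i = i k. *)
definition discrete_hist ::
  "('x::real_normed_vector \<Rightarrow>\<^sub>L 'y::real_normed_vector) \<Rightarrow> (real \<Rightarrow> real \<Rightarrow> 'x \<Rightarrow>\<^sub>L 'x) \<Rightarrow> 'x \<Rightarrow>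
    real \<Rightarrow> nat \<Rightarrow> (nat \<Rightarrow> 'x) \<Rightarrow> 'y" where
  "discrete_hist R q a k n v =
     (let t = (\<lambda>i::nat. real i * k) in
      if n = 0 then R a
      else R ((k / 2) *\<^sub>R q (t n) (t 0) (v 0)
              + k *\<^sub>R (\<Sum>i = 1..n - 1. q (t n) (t i) (v i))
              + (k / 2) *\<^sub>R q (t n) (t (n - 1)) (v (n - 1))
              + a))"

end

theory Submission
  imports Defs
begin

text \<open>
  The discrete history operator at level \<open>n\<close> only involves \<open>u 0, ..., u (n - 1)\<close>. Hence the
  scheme is a recursion (\<open>causal_unique_choice\<close>), and it suffices that for a given value \<open>y\<close> of
  the history operator the stationary inequality has exactly one solution in \<open>K\<close>
  (\<open>variational_hemivariational_inequality\<close>). The step size enters this inequality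
  only through its data \<open>y\<close> and \<open>f\<close>, which is why it is not restricted.

  The stationary inequality is an equilibrium problem: find \<open>u \<in> K\<close> with \<open>F u v \<ge> 0\<close> for all
  \<open>v \<in> K\<close>, where
  \<open>F u v = (A u - f) (v - u) + \<phi> y u v - \<phi> y u u + j0 (\<gamma> u; \<gamma> v - \<gamma> u)\<close>
  and \<open>j0\<close> is the Clarke derivative. The function \<open>F u\<close> is convex and lower semicontinuous, and the
  assumptions on \<open>A\<close>, \<open>\<phi>\<close> and \<open>j\<close> add up to
  \<open>F u v + F v u \<le> - (m\<^sub>A - \<alpha>\<^sub>\<phi> - \<alpha>\<^sub>j c\<^sub>j\<^sup>2) * (norm (u - v))\<^sup>2\<close>.
  As the factor in parentheses is positive, two solutions coincide.

  For existence, one looks for \<open>u\<close> satisfying the dual inequalities \<open>F v u \<le> 0\<close>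
  (\<open>strongly_monotone_equilibrium_minty\<close>). Up to a quadratic correction, these describe
  bounded closed convex sets. Finitely many of them, relaxed by a positive tolerance,
  intersect: otherwise an alternative theorem for convex functions (\<open>convex_alternative\<close>) and the
  barycentre of its multipliers would contradict monotonicity. In a reflexive space all of them then
  have a common point (\<open>reflexive_closed_convex_fip\<close>), a form of weak compactness that rests on the
  Hahn-Banach theorem (\<open>sublinear_dominates_linear\<close>). Finally, the dual inequalities imply the
  original ones by approaching \<open>u\<close> along segments, since \<open>A\<close> is continuous and the Clarke
  derivative is upper semicontinuous in its base point.
\<close>

section \<open>Sublinear functionals and the Hahn-Banach principle\<close>

definition sublinear :: "('a::real_vector \<Rightarrow> real) \<Rightarrow> bool" where
  "sublinear p \<longleftrightarrow> (\<forall>x y. p (x + y) \<le> p x + p y) \<and> (\<forall>t>0. \<forall>x. p (t *\<^sub>R x) \<le> t * p x)"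

lemma sublinear_add: "sublinear p \<Longrightarrow> p (x + y) \<le> p x + p y"
  by (simp add: sublinear_def)

lemma sublinear_zero:
  assumes "sublinear p" shows "p 0 = 0"
proof -
  have "p 0 \<le> p 0 + p 0"
    using sublinear_add[OF assms, of 0 0] by simp
  moreover have "p ((1/2) *\<^sub>R 0) \<le> (1/2) * p 0"
    using assms unfolding sublinear_def by (metis half_gt_zero zero_less_one)
  ultimately show ?thesis by simp
qed

lemma sublinear_scaleR:
  assumes "sublinear p" "t \<ge> 0" shows "p (t *\<^sub>R x) = t * p x"
proof (cases "t = 0")
  case True
  then show ?thesis using sublinear_zero[OF assms(1)] by simp
next
  case False
  with assms have t: "t > 0" by simp
  have "p x = p (inverse t *\<^sub>R (t *\<^sub>R x))"
    using t by simp
  also have "\<dots> \<le> inverse t * p (t *\<^sub>R x)"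
    using assms(1) t unfolding sublinear_def by (metis inverse_positive_iff_positive)
  finally have "t * p x \<le> p (t *\<^sub>R x)"
    using t by (simp add: field_simps)
  moreover have "p (t *\<^sub>R x) \<le> t * p x"
    using assms(1) t by (simp add: sublinear_def)
  ultimately show ?thesis by simp
qed

text \<open>Every sublinear functional below arises as an infimum of admissible bounds; this lemma
  reduces sublinearity to two closure properties of the sets of bounds.\<close>
lemma sublinear_Inf:
  fixes S :: "'a::real_vector \<Rightarrow> real set"
  assumes ne: "\<And>x. S x \<noteq> {}" and bdd: "\<And>x. bdd_below (S x)"
    and add: "\<And>x y a b. a \<in> S x \<Longrightarrow> b \<in> S y \<Longrightarrow> \<exists>c\<in>S (x + y). c \<le> a + b"
    and scale: "\<And>t x a. t > 0 \<Longrightarrow> a \<in> S x \<Longrightarrow> \<exists>c\<in>S (t *\<^sub>R x). c \<le> t * a"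
  shows "sublinear (\<lambda>x. Inf (S x))"
  unfolding sublinear_def
proof (intro conjI allI impI)
  fix x y
  have *: "Inf (S (x + y)) \<le> a + b" if "a \<in> S x" "b \<in> S y" for a b
    using add[OF that] cInf_lower[OF _ bdd] by (meson order_trans)
  have "Inf (S (x + y)) - Inf (S x) \<le> b" if b: "b \<in> S y" for b
  proof -
    have "Inf (S (x + y)) - b \<le> Inf (S x)"
      by (rule cInf_greatest[OF ne]) (use * b in \<open>fastforce simp: algebra_simps\<close>)
    then show ?thesis by simp
  qed
  then have "Inf (S (x + y)) - Inf (S x) \<le> Inf (S y)"
    by (rule cInf_greatest[OF ne])
  then show "Inf (S (x + y)) \<le> Inf (S x) + Inf (S y)" by simp
next
  fix t :: real and x assume t: "t > 0"
  have "Inf (S (t *\<^sub>R x)) / t \<le> Inf (S x)"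
  proof (rule cInf_greatest[OF ne])
    fix a assume "a \<in> S x"
    from scale[OF t this] have "Inf (S (t *\<^sub>R x)) \<le> t * a"
      using cInf_lower[OF _ bdd] by (meson order_trans)
    then show "Inf (S (t *\<^sub>R x)) / t \<le> a"
      using t by (simp add: field_simps)
  qed
  then show "Inf (S (t *\<^sub>R x)) \<le> t * Inf (S x)"
    using t by (simp add: field_simps)
qed

text \<open>For fixed \<open>y\<close>, the functional \<open>z \<mapsto> inf {q (z + t y) - t q y | t \<ge> 0}\<close>
  is sublinear and lies below \<open>q\<close>. Minimality makes it equal to \<open>q\<close>, and the choice
  \<open>t = 1\<close> then gives superadditivity of \<open>q\<close>.\<close>
lemma minimal_sublinear_linear:
  assumes q: "sublinear q" and min: "\<And>r. sublinear r \<Longrightarrow> r \<le> q \<Longrightarrow> r = q"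
  shows "linear q"
proof -
  have super: "q x + q y \<le> q (x + y)" for x y
  proof -
    define S where "S z = {q (z + t *\<^sub>R y) - t * q y | t. t \<ge> 0}" for z
    have lower: "- q (- z) \<le> q (z + t *\<^sub>R y) - t * q y" if "t \<ge> 0" for z t
      using sublinear_add[OF q, of "z + t *\<^sub>R y" "- z"] sublinear_scaleR[OF q that, of y] by simp
    have bdd: "bdd_below (S z)" for z
      unfolding S_def using lower by (intro bdd_belowI[of _ "- q (- z)"]) auto
    have mem: "q (z + t *\<^sub>R y) - t * q y \<in> S z" if "t \<ge> 0" for z t
      using that unfolding S_def by blast
    have "sublinear (\<lambda>z. Inf (S z))"
    proof (rule sublinear_Inf[OF _ bdd])
      show "S z \<noteq> {}" for z using mem[of 0] by blast
    next
      fix z w a b assume "a \<in> S z" "b \<in> S w"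
      then obtain s t where st: "s \<ge> 0" "t \<ge> 0" "a = q (z + s *\<^sub>R y) - s * q y"
        "b = q (w + t *\<^sub>R y) - t * q y"
        unfolding S_def by blast
      have "q ((z + w) + (s + t) *\<^sub>R y) \<le> q (z + s *\<^sub>R y) + q (w + t *\<^sub>R y)"
        using sublinear_add[OF q, of "z + s *\<^sub>R y" "w + t *\<^sub>R y"] by (simp add: algebra_simps)
      then show "\<exists>c\<in>S (z + w). c \<le> a + b"
        using st mem[of "s + t" "z + w"] by (intro bexI) (auto simp: algebra_simps)
    next
      fix t :: real and z a assume t: "t > 0" and "a \<in> S z"
      then obtain s where s: "s \<ge> 0" "a = q (z + s *\<^sub>R y) - s * q y"
        unfolding S_def by blast
      have "q (t *\<^sub>R z + (t * s) *\<^sub>R y) = t * q (z + s *\<^sub>R y)"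
        using sublinear_scaleR[OF q, of t "z + s *\<^sub>R y"] t by (simp add: algebra_simps)
      then have "q (t *\<^sub>R z + (t * s) *\<^sub>R y) - t * s * q y = t * a"
        unfolding s(2) by (simp add: right_diff_distrib)
      then show "\<exists>c\<in>S (t *\<^sub>R z). c \<le> t * a"
        using s(1) t mem[of "t * s" "t *\<^sub>R z"] by auto
    qed
    moreover have "(\<lambda>z. Inf (S z)) \<le> q"
      using cInf_lower[OF mem bdd, of 0] by (simp add: le_fun_def)
    ultimately have "Inf (S x) = q x"
      using min by metis
    then show ?thesis
      using cInf_lower[OF mem bdd, of 1 x] by simp
  qed
  have add: "q (x + y) = q x + q y" for x y
    using super[of x y] sublinear_add[OF q, of x y] by simp
  have neg: "q (- x) = - q x" for x
    using add[of x "- x"] sublinear_zero[OF q] by simp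
  have "q (t *\<^sub>R x) = t * q x" for t x
  proof (cases "t \<ge> 0")
    case False
    then show ?thesis
      using sublinear_scaleR[OF q, of "- t" x] neg[of "t *\<^sub>R x"] by simp
  qed (simp add: sublinear_scaleR[OF q])
  with add show ?thesis by (intro linearI) auto
qed

text \<open>This is the Hahn-Banach theorem in the form without a subspace: Zorn's lemma
  yields a minimal sublinear functional below \<open>p\<close>, because the pointwise infimum of a chain is
  sublinear. A prescribed value at a point is not built in; the applications
  encode such requirements in the choice of \<open>p\<close>.\<close>
lemma sublinear_dominates_linear:
  assumes p: "sublinear p"
  obtains \<Phi> where "linear \<Phi>" "\<And>x. \<Phi> x \<le> p x"
proof -
  define Q where "Q = {q. sublinear q \<and> q \<le> p}"
  have "\<exists>m\<in>Q. \<forall>q\<in>Q. m \<ge> q \<longrightarrow> q = m"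
  proof (rule predicate_Zorn)
    show "partial_order_on Q (relation_of (\<ge>) Q)"
      by (rule partial_order_on_relation_ofI) auto
  next
    fix C assume C: "C \<in> Chains (relation_of (\<ge>) Q)"
    show "\<exists>u\<in>Q. \<forall>a\<in>C. a \<ge> u"
    proof (cases "C = {}")
      case True
      then show ?thesis using p unfolding Q_def by auto
    next
      case False
      have CQ: "sublinear q" "q \<le> p" if "q \<in> C" for q
        using C that unfolding Chains_def relation_of_def Q_def by auto
      have chain: "q \<le> r \<or> r \<le> q" if "q \<in> C" "r \<in> C" for q r
        using C that unfolding Chains_def relation_of_def by auto
      define S where "S x = (\<lambda>q. q x) ` C" for x
      have bdd: "bdd_below (S x)" for x
      proof (rule bdd_belowI[of _ "- p (- x)"])
        fix a assume "a \<in> S x"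
        then obtain q where q: "q \<in> C" "a = q x" unfolding S_def by blast
        have "0 \<le> q x + q (- x)"
          using sublinear_add[OF CQ(1)[OF q(1)], of x "- x"] sublinear_zero[OF CQ(1)[OF q(1)]] by simp
        with CQ(2)[OF q(1)] q(2) show "- p (- x) \<le> a"
          by (smt (verit) le_funD)
      qed
      have lower: "(\<lambda>x. Inf (S x)) \<le> q" if "q \<in> C" for q
        using cInf_lower[OF _ bdd] that by (simp add: le_fun_def S_def)
      have "sublinear (\<lambda>x. Inf (S x))"
      proof (rule sublinear_Inf[OF _ bdd])
        show "S x \<noteq> {}" for x using False by (simp add: S_def)
      next
        fix x y a b assume "a \<in> S x" "b \<in> S y"
        then obtain q r where qr: "q \<in> C" "r \<in> C" "a = q x" "b = r y"
          unfolding S_def by blast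
        from chain[OF qr(1,2)] obtain w where w: "w \<in> C" "w \<le> q" "w \<le> r"
          using qr by blast
        have "w (x + y) \<le> w x + w y" by (rule sublinear_add[OF CQ(1)[OF w(1)]])
        also have "\<dots> \<le> a + b"
          using w qr by (auto simp: le_fun_def intro: add_mono)
        finally show "\<exists>c\<in>S (x + y). c \<le> a + b"
          using w(1) by (auto simp: S_def)
      next
        fix t :: real and x a assume "t > 0" "a \<in> S x"
        then show "\<exists>c\<in>S (t *\<^sub>R x). c \<le> t * a"
          using CQ(1) unfolding S_def sublinear_def by blast
      qed
      moreover have "(\<lambda>x. Inf (S x)) \<le> p"
        using lower CQ(2) False by (metis equals0I order_trans)
      ultimately show ?thesis
        using lower unfolding Q_def by blast
    qed
  qed
  then obtain q where q: "sublinear q" "q \<le> p" and min: "\<And>r. sublinear r \<Longrightarrow> r \<le> p \<Longrightarrow> r \<le> q \<Longrightarrow> r = q"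
    unfolding Q_def by auto
  have "linear q"
    using q min by (intro minimal_sublinear_linear) (auto intro: order_trans)
  with q(2) show ?thesis
    by (intro that) (auto simp: le_fun_def)
qed

lemma linear_dominated_blinfun:
  fixes \<Phi> :: "'a::real_normed_vector \<Rightarrow> real"
  assumes "linear \<Phi>" "\<And>x. \<Phi> x \<le> M * norm x"
  obtains \<xi> :: "'a dual" where "\<And>x. \<xi> x = \<Phi> x"
proof -
  have "bounded_linear \<Phi>"
  proof (intro bounded_linear_intro)
    show "norm (\<Phi> x) \<le> norm x * M" for x
      using assms(2)[of x] assms(2)[of "- x"] linear_neg[OF assms(1), of x] by (simp add: mult.commute)
  qed (use assms(1) in \<open>simp_all add: linear_add linear_scale\<close>)
  then show ?thesis
    using that[of "Blinfun \<Phi>"] by (simp add: bounded_linear_Blinfun_apply)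
qed

text \<open>With \<open>d\<close> the distance of \<open>u\<close> from \<open>C\<close>, the functional
  \<open>z \<mapsto> inf {norm (z + t (x - u)) - t d | t \<ge> 0, x \<in> C}\<close> is sublinear, at most the norm, and at most
  \<open>- d\<close> at each \<open>u - x\<close>. Any linear functional below it is bounded and
  separates \<open>u\<close> from \<open>C\<close>.\<close>
lemma separate_point_closed_convex:
  fixes C :: "'a::real_normed_vector set"
  assumes "closed C" "convex C" "C \<noteq> {}" "u \<notin> C"
  obtains \<xi> :: "'a dual" and d where "d > 0" "\<And>x. x \<in> C \<Longrightarrow> \<xi> u + d \<le> \<xi> x"
proof -
  define d where "d = infdist u C"
  have d: "d > 0"
    unfolding d_def using assms(1,3,4) in_closed_iff_infdist_zero[of C u] infdist_nonneg[of u C] by fastforce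
  have dist: "d \<le> norm (x - u)" if "x \<in> C" for x
    using infdist_le[OF that, of u] by (simp add: d_def dist_norm norm_minus_commute)
  define S where "S z = {norm (z + t *\<^sub>R (x - u)) - t * d | t x. t \<ge> 0 \<and> x \<in> C}" for z
  have mem: "norm (z + t *\<^sub>R (x - u)) - t * d \<in> S z" if "t \<ge> 0" "x \<in> C" for t x z
    using that unfolding S_def by blast
  \<comment> \<open>Here the distance enters: moving by \<open>t (x - u)\<close> costs at least \<open>t d\<close>.\<close>
  have bdd: "bdd_below (S z)" for z
  proof (rule bdd_belowI[of _ "- norm z"])
    fix a assume "a \<in> S z"
    then obtain t x where tx: "t \<ge> 0" "x \<in> C" "a = norm (z + t *\<^sub>R (x - u)) - t * d"
      unfolding S_def by blast
    have "t * d \<le> norm (t *\<^sub>R (x - u))"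
      using tx dist by (simp add: mult_left_mono)
    then show "- norm z \<le> a"
      using norm_triangle_ineq4[of "z + t *\<^sub>R (x - u)" z] tx(3) by simp
  qed
  obtain x0 where x0: "x0 \<in> C" using assms(3) by blast
  have "sublinear (\<lambda>z. Inf (S z))"
  proof (rule sublinear_Inf[OF _ bdd])
    show "S z \<noteq> {}" for z using mem[OF _ x0] by blast
  next
    fix z w a b assume "a \<in> S z" "b \<in> S w"
    then obtain s t x y where st: "s \<ge> 0" "t \<ge> 0" "x \<in> C" "y \<in> C"
      "a = norm (z + s *\<^sub>R (x - u)) - s * d" "b = norm (w + t *\<^sub>R (y - u)) - t * d"
      unfolding S_def by blast
    obtain v where v: "v \<in> C" "(s + t) *\<^sub>R (v - u) = s *\<^sub>R (x - u) + t *\<^sub>R (y - u)"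
    proof (cases "s + t = 0")
      case True
      with st(1,2) have "s = 0" "t = 0" by simp_all
      with st(3) show ?thesis using that[of x] by simp
    next
      case False
      define v where "v = (s / (s + t)) *\<^sub>R x + (t / (s + t)) *\<^sub>R y"
      have "v \<in> C"
        unfolding v_def using assms(2) st False by (intro convexD) (auto simp flip: add_divide_distrib)
      moreover have "(s + t) *\<^sub>R v = s *\<^sub>R x + t *\<^sub>R y"
        using False by (simp add: v_def scaleR_add_right)
      ultimately show ?thesis
        by (intro that) (simp_all add: scaleR_diff_right scaleR_left.add algebra_simps)
    qed
    have "(z + w) + (s + t) *\<^sub>R (v - u) = (z + s *\<^sub>R (x - u)) + (w + t *\<^sub>R (y - u))"
      by (simp add: v(2))
    then have "norm ((z + w) + (s + t) *\<^sub>R (v - u)) \<le> norm (z + s *\<^sub>R (x - u)) + norm (w + t *\<^sub>R (y - u))"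
      by (metis norm_triangle_ineq)
    then show "\<exists>c\<in>S (z + w). c \<le> a + b"
      using st v(1) mem[of "s + t" v "z + w"] by (intro bexI) (auto simp: algebra_simps)
  next
    fix t :: real and z a assume t: "t > 0" and "a \<in> S z"
    then obtain s x where s: "s \<ge> 0" "x \<in> C" "a = norm (z + s *\<^sub>R (x - u)) - s * d"
      unfolding S_def by blast
    have "t *\<^sub>R z + (t * s) *\<^sub>R (x - u) = t *\<^sub>R (z + s *\<^sub>R (x - u))"
      by (simp add: algebra_simps)
    then have "norm (t *\<^sub>R z + (t * s) *\<^sub>R (x - u)) = t * norm (z + s *\<^sub>R (x - u))"
      using t by (simp only: norm_scaleR abs_of_pos)
    then have "norm (t *\<^sub>R z + (t * s) *\<^sub>R (x - u)) - t * s * d = t * a"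
      unfolding s(3) by (simp add: right_diff_distrib)
    then show "\<exists>c\<in>S (t *\<^sub>R z). c \<le> t * a"
      using s(1,2) t mem[of "t * s" x "t *\<^sub>R z"] by auto
  qed
  then obtain \<Phi> where \<Phi>: "linear \<Phi>" "\<And>z. \<Phi> z \<le> Inf (S z)"
    using sublinear_dominates_linear by blast
  have "Inf (S z) \<le> norm z" for z
    using cInf_lower[OF mem[OF _ x0] bdd, of 0 z] by simp
  with \<Phi>(2) have "\<Phi> z \<le> 1 * norm z" for z
    by (metis mult_1 order_trans)
  then obtain \<xi> :: "'a dual" where \<xi>: "\<And>x. \<xi> x = \<Phi> x"
    using linear_dominated_blinfun[OF \<Phi>(1)] by blast
  have "\<xi> u + d \<le> \<xi> x" if "x \<in> C" for x
  proof -
    have "\<Phi> (u - x) \<le> - d"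
      using \<Phi>(2)[of "u - x"] cInf_lower[OF mem[OF _ that] bdd, of 1 "u - x"] by simp
    then show ?thesis by (simp add: \<xi> linear_diff[OF \<Phi>(1)])
  qed
  with d show ?thesis by (rule that)
qed

section \<open>Intersections of closed convex sets in reflexive spaces\<close>

text \<open>Weak compactness of bounded closed convex sets, obtained without the weak topology. The
  functional on the dual that sends \<open>\<xi>\<close> to the infimum, over the finite intersections, of the
  supremum of \<open>\<xi>\<close> is sublinear. A linear functional below it is a bounded element of the bidual,
  hence evaluation at a point \<open>u\<close> by reflexivity. If \<open>u\<close> were outside some \<open>C i\<close>, a
  separating functional would contradict the domination.\<close>
lemma reflexive_closed_convex_fip:
  fixes C :: "'i \<Rightarrow> 'a::real_normed_vector set"
  assumes refl: "reflexive TYPE('a)"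
    and cc: "\<And>i. i \<in> I \<Longrightarrow> closed (C i)" "\<And>i. i \<in> I \<Longrightarrow> convex (C i)"
    and i0: "i0 \<in> I" "bounded (C i0)"
    and fip: "\<And>J. finite J \<Longrightarrow> J \<subseteq> I \<Longrightarrow> (\<Inter>i\<in>J. C i) \<noteq> {}"
  shows "(\<Inter>i\<in>I. C i) \<noteq> {}"
proof -
  obtain M where M: "\<And>x. x \<in> C i0 \<Longrightarrow> norm x \<le> M"
    using i0(2) unfolding bounded_iff by blast
  define S where "S \<xi> = {a. \<exists>J. finite J \<and> J \<subseteq> I \<and> i0 \<in> J \<and> (\<forall>x\<in>(\<Inter>i\<in>J. C i). blinfun_apply \<xi> x \<le> a)}"
    for \<xi> :: "'a dual"
  have bound: "\<bar>blinfun_apply \<xi> x\<bar> \<le> M * norm \<xi>" if "x \<in> C i0" for x and \<xi> :: "'a dual"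
    using norm_blinfun[of \<xi> x] mult_left_mono[OF M[OF that], of "norm \<xi>"] by (simp add: mult.commute)
  have upper: "M * norm \<xi> \<in> S \<xi>" for \<xi>
    unfolding S_def using bound[of _ \<xi>] i0 by (intro CollectI exI[of _ "{i0}"]) (auto simp: abs_le_iff)
  have bdd: "bdd_below (S \<xi>)" for \<xi>
  proof (rule bdd_belowI[of _ "- (M * norm \<xi>)"])
    fix a assume "a \<in> S \<xi>"
    then obtain J where J: "finite J" "J \<subseteq> I" "i0 \<in> J" "\<forall>x\<in>(\<Inter>i\<in>J. C i). blinfun_apply \<xi> x \<le> a"
      unfolding S_def by blast
    obtain x where "x \<in> (\<Inter>i\<in>J. C i)" using fip[OF J(1,2)] by blast
    with J bound[of x \<xi>] show "- (M * norm \<xi>) \<le> a" by fastforce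
  qed
  have "sublinear (\<lambda>\<xi>. Inf (S \<xi>))"
  proof (rule sublinear_Inf[OF _ bdd])
    show "S \<xi> \<noteq> {}" for \<xi> using upper by blast
  next
    fix \<xi> \<eta> a b assume "a \<in> S \<xi>" "b \<in> S \<eta>"
    then obtain J L where J: "finite J" "J \<subseteq> I" "i0 \<in> J" "\<forall>x\<in>(\<Inter>i\<in>J. C i). blinfun_apply \<xi> x \<le> a"
      and L: "finite L" "L \<subseteq> I" "\<forall>x\<in>(\<Inter>i\<in>L. C i). blinfun_apply \<eta> x \<le> b"
      unfolding S_def by blast
    have "a + b \<in> S (\<xi> + \<eta>)"
      unfolding S_def using J L
      by (intro CollectI exI[of _ "J \<union> L"]) (auto simp: blinfun.add_left intro!: add_mono)
    then show "\<exists>c\<in>S (\<xi> + \<eta>). c \<le> a + b" by blast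
  next
    fix t :: real and \<xi> a assume "t > 0" "a \<in> S \<xi>"
    then have "t * a \<in> S (t *\<^sub>R \<xi>)"
      unfolding S_def by (auto simp: blinfun.scaleR_left)
    then show "\<exists>c\<in>S (t *\<^sub>R \<xi>). c \<le> t * a" by blast
  qed
  then obtain \<Phi> where \<Phi>: "linear \<Phi>" "\<And>\<xi>. \<Phi> \<xi> \<le> Inf (S \<xi>)"
    using sublinear_dominates_linear by blast
  have \<Phi>S: "\<Phi> \<xi> \<le> a" if "a \<in> S \<xi>" for \<xi> a
    using \<Phi>(2)[of \<xi>] cInf_lower[OF that bdd] by simp
  then obtain \<Psi> :: "'a dual dual" where \<Psi>: "\<And>\<xi>. \<Psi> \<xi> = \<Phi> \<xi>"
    using linear_dominated_blinfun[OF \<Phi>(1)] upper by blast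
  obtain u where "\<Psi> = canonical_embedding u"
    using refl unfolding reflexive_def by (metis surjD)
  then have u: "\<Phi> \<xi> = \<xi> u" for \<xi>
    by (metis \<Psi> canonical_embedding_apply)
  have "u \<in> C i" if i: "i \<in> I" for i
  proof (rule ccontr)
    assume "u \<notin> C i"
    moreover have "C i \<noteq> {}" using fip[of "{i}"] i by simp
    ultimately obtain \<xi> :: "'a dual" and d where "d > 0" and sep: "\<And>x. x \<in> C i \<Longrightarrow> \<xi> u + d \<le> \<xi> x"
      using separate_point_closed_convex[OF cc[OF i]] by metis
    have "- \<xi> u - d \<in> S (- \<xi>)"
      unfolding S_def using i i0(1) sep
      by (intro CollectI exI[of _ "{i0, i}"]) (force simp: blinfun.minus_left)
    then have "\<Phi> (- \<xi>) \<le> - \<xi> u - d" by (rule \<Phi>S)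
    with \<open>d > 0\<close> show False by (simp add: u blinfun.minus_left)
  qed
  then show ?thesis by blast
qed

section \<open>An alternative for finitely many convex functions\<close>

lemma convex_on_sublevel:
  assumes "convex_on C g" shows "convex {x \<in> C. g x \<le> (a::real)}"
proof (rule convexI)
  fix x y and s t :: real
  assume xy: "x \<in> {x \<in> C. g x \<le> a}" "y \<in> {x \<in> C. g x \<le> a}" and st: "0 \<le> s" "0 \<le> t" "s + t = 1"
  have "g (s *\<^sub>R x + t *\<^sub>R y) \<le> s * g x + t * g y"
    using assms xy st unfolding convex_on_def by auto
  also have "\<dots> \<le> a"
    using xy st by (intro convex_bound_le) auto
  finally show "s *\<^sub>R x + t *\<^sub>R y \<in> {x \<in> C. g x \<le> a}"
    using assms xy st unfolding convex_on_def by (auto intro: convexD)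
qed

lemma convex_on_sum_functions:
  fixes g :: "'i \<Rightarrow> 'a::real_vector \<Rightarrow> real"
  assumes "finite I" "convex C" "\<And>i. i \<in> I \<Longrightarrow> convex_on C (g i)"
  shows "convex_on C (\<lambda>x. \<Sum>i\<in>I. g i x)"
  using assms by (induction I rule: finite_induct) (auto simp: convex_on_const)

lemma convex_on_strict_sublevel:
  assumes "convex_on C g" shows "convex {x \<in> C. g x < (0::real)}"
proof (rule convexI)
  fix x y and s t :: real
  assume xy: "x \<in> {x \<in> C. g x < 0}" "y \<in> {x \<in> C. g x < 0}" and st: "0 \<le> s" "0 \<le> t" "s + t = 1"
  have "g (s *\<^sub>R x + t *\<^sub>R y) \<le> s * g x + t * g y"
    using assms xy st unfolding convex_on_def by auto
  also have "\<dots> < 0"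
    using xy st by (smt (verit) mem_Collect_eq mult_nonneg_nonpos mult_pos_neg)
  finally show "s *\<^sub>R x + t *\<^sub>R y \<in> {x \<in> C. g x < 0}"
    using assms xy st unfolding convex_on_def by (auto intro: convexD)
qed

text \<open>The multiplier is \<open>s = inf {h x / (- g x) | x \<in> C, g x < 0}\<close>, the largest
  admissible one for the points with \<open>g < 0\<close>. At a point \<open>y\<close> with \<open>g y \<ge> 0\<close> and
  \<open>h y < 0\<close>, a failure would provide a point of a segment from \<open>x\<close> to \<open>y\<close> at which
  both functions are negative.\<close>
lemma convex_alternative_two:
  fixes g h :: "'a::real_vector \<Rightarrow> real"
  assumes g: "convex_on C g" and h: "convex_on C h"
    and alt: "\<And>x. x \<in> C \<Longrightarrow> g x < 0 \<Longrightarrow> h x \<ge> 0"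
    and x0: "x0 \<in> C" "g x0 < 0"
  obtains s where "s \<ge> 0" "\<And>x. x \<in> C \<Longrightarrow> h x + s * g x \<ge> 0"
proof -
  have cross: "h y * g x \<le> h x * g y" if xy: "x \<in> C" "y \<in> C" "g x < 0" "g y \<ge> 0" "h y < 0" for x y
  proof (rule ccontr)
    assume *: "\<not> h y * g x \<le> h x * g y"
    have hx: "h x \<ge> 0" using alt xy by simp
    (* With weight ratio h x / (- h y), the combination of h vanishes and that of g equals -D.
       A slightly larger ratio makes both negative. *)
    define D where "D = (h y * g x - h x * g y) / (- h y)"
    have D: "D > 0" unfolding D_def using * xy(5) by (intro divide_pos_pos) auto
    define r where "r = h x / (- h y) + D / (g y + 1)"
    have "h x + r * h y = D / (g y + 1) * h y"
      using xy(5) by (simp add: r_def algebra_simps)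
    also have "\<dots> < 0" using D xy by (simp add: mult_pos_neg divide_neg_pos)
    finally have r1: "h x + r * h y < 0" .
    have "g x + r * g y = D * g y / (g y + 1) - D"
      using xy(5) by (simp add: r_def D_def field_simps)
    also have "\<dots> < 0" using D xy(4) by (simp add: field_simps)
    finally have r2: "g x + r * g y < 0" .
    have "r \<ge> 0" unfolding r_def using D hx xy(4,5) by (intro add_nonneg_nonneg divide_nonneg_pos) simp_all
    note r = r1 r2 this
    define t where "t = r / (1 + r)"
    have t: "0 \<le> t" "t \<le> 1" "1 - t = 1 / (1 + r)"
      using r(3) by (auto simp: t_def field_simps)
    have eq: "(1 - t) * a + t * b = (a + r * b) / (1 + r)" for a b
      unfolding t(3) unfolding t_def by (simp add: add_divide_distrib)
    have "g ((1 - t) *\<^sub>R x + t *\<^sub>R y) < 0" "h ((1 - t) *\<^sub>R x + t *\<^sub>R y) < 0"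
      using convex_onD[OF g t(1,2) xy(1,2)] convex_onD[OF h t(1,2) xy(1,2)] r
      by (auto simp: eq divide_neg_pos elim!: order.strict_trans1)
    moreover have "(1 - t) *\<^sub>R x + t *\<^sub>R y \<in> C"
      using g xy(1,2) t(1,2) unfolding convex_on_def by (intro convexD_alt) blast+
    ultimately show False using alt by fastforce
  qed
  define S where "S = (\<lambda>x. h x / (- g x)) ` {x \<in> C. g x < 0}"
  have S0: "S \<noteq> {}" using x0 by (auto simp: S_def)
  have pos: "0 \<le> b" if "b \<in> S" for b using that alt unfolding S_def by (auto simp: divide_nonneg_pos divide_nonneg_neg)
  then have bdd: "bdd_below S" by (rule bdd_belowI)
  have "h y + Inf S * g y \<ge> 0" if y: "y \<in> C" for y
  proof -
    consider "g y < 0" | "g y \<ge> 0" "h y \<ge> 0" | "g y = 0" "h y < 0" | "g y > 0" "h y < 0" by linarith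
    then show ?thesis
    proof cases
      case 1
      then have "Inf S \<le> h y / (- g y)"
        using y by (intro cInf_lower[OF _ bdd]) (auto simp: S_def)
      with 1 show ?thesis by (simp add: field_simps)
    next
      case 2
      then show ?thesis using cInf_greatest[OF S0 pos] by simp
    next
      case 3
      then show ?thesis using cross[OF x0(1) y x0(2)] x0(2) by (simp add: mult_le_0_iff)
    next
      case 4
      have "- h y / g y \<le> Inf S"
      proof (rule cInf_greatest[OF S0])
        fix b assume "b \<in> S"
        then obtain x where x: "x \<in> C" "g x < 0" "b = h x / (- g x)" by (auto simp: S_def)
        define p where "p = - g x"
        have p: "p > 0" "b = h x / p" using x by (simp_all add: p_def)
        have "h y * g x \<le> h x * g y" using cross x y 4 by simp
        then have "- h y * p \<le> h x * g y" by (simp add: p_def)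
        then show "- h y / g y \<le> b" 
          unfolding p(2) using p(1) 4 by (simp add: field_simps)
      qed
      with 4 show ?thesis by (simp add: field_simps)
    qed
  qed
  with cInf_greatest[OF S0 pos] show ?thesis by (rule that)
qed

text \<open>The theorem of Fan, Glicksberg and Hoffman: if finitely many convex functions are never
  simultaneously negative, some convex combination of them is nonnegative. In the induction step,
  the hypothesis is applied on the set where the new function is negative, and the result is merged
  with the new function by the case of two functions.\<close>
lemma convex_alternative:
  fixes g :: "'i \<Rightarrow> 'a::real_vector \<Rightarrow> real"
  assumes "finite I" "\<And>i. i \<in> I \<Longrightarrow> convex_on C (g i)" "C \<noteq> {}"
    "\<And>x. x \<in> C \<Longrightarrow> \<exists>i\<in>I. g i x \<ge> 0"
  shows "\<exists>\<mu>. (\<forall>i\<in>I. \<mu> i \<ge> 0) \<and> sum \<mu> I = 1 \<and> (\<forall>x\<in>C. (\<Sum>i\<in>I. \<mu> i * g i x) \<ge> 0)"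
  using assms
proof (induction I arbitrary: C rule: finite_induct)
  case empty
  then show ?case by blast
next
  case (insert i I)
  let ?C = "{x \<in> C. g i x < 0}"
  show ?case
  proof (cases "?C = {}")
    case True
    have "(\<Sum>k\<in>insert i I. (if k = i then 1 else 0) * g k x) = g i x" for x
      using insert.hyps by (subst sum.remove[of _ i]) (auto intro: sum.neutral)
    moreover have "sum (\<lambda>k. if k = i then 1 else (0::real)) (insert i I) = 1"
      using insert.hyps by simp
    ultimately show ?thesis
      using True by (intro exI[of _ "\<lambda>k. if k = i then 1 else 0"]) auto
  next
    case False
    have conv: "convex_on C (g k)" if "k \<in> insert i I" for k using insert.prems(1) that by blast
    have "\<exists>\<mu>. (\<forall>k\<in>I. \<mu> k \<ge> 0) \<and> sum \<mu> I = 1 \<and> (\<forall>x\<in>?C. (\<Sum>k\<in>I. \<mu> k * g k x) \<ge> 0)"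
    proof (rule insert.IH[OF _ False])
      show "convex_on ?C (g k)" if "k \<in> I" for k
        using conv that convex_on_strict_sublevel[OF conv[of i]] by (intro convex_on_subset[OF conv]) auto
      show "\<exists>k\<in>I. 0 \<le> g k x" if "x \<in> ?C" for x
        using insert.prems(3)[of x] that by auto
    qed
    then obtain \<mu> where \<mu>: "\<And>k. k \<in> I \<Longrightarrow> \<mu> k \<ge> 0" "sum \<mu> I = 1"
      "\<And>x. x \<in> ?C \<Longrightarrow> (\<Sum>k\<in>I. \<mu> k * g k x) \<ge> 0" by blast
    obtain x0 where x0: "x0 \<in> C" "g i x0 < 0" using False by blast
    have "convex_on C (\<lambda>x. \<Sum>k\<in>I. \<mu> k * g k x)"
      using insert.hyps(1) conv \<mu>(1)
      by (intro convex_on_sum_functions convex_on_cmul) (auto simp: convex_on_def)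
    then obtain s where s: "s \<ge> 0" "\<And>x. x \<in> C \<Longrightarrow> (\<Sum>k\<in>I. \<mu> k * g k x) + s * g i x \<ge> 0"
      using convex_alternative_two[OF conv[of i] _ _ x0] \<mu>(3) by (smt (verit) insertI1 mem_Collect_eq)
    define \<nu> where "\<nu> k = (if k = i then s else \<mu> k) / (1 + s)" for k
    have sum: "(\<Sum>k\<in>insert i I. \<nu> k * f k) = ((\<Sum>k\<in>I. \<mu> k * f k) + s * f i) / (1 + s)" for f
    proof -
      have "(\<Sum>k\<in>I. \<nu> k * f k) = (\<Sum>k\<in>I. \<mu> k * f k) / (1 + s)"
        unfolding sum_divide_distrib using insert.hyps by (intro sum.cong) (auto simp: \<nu>_def)
      then show ?thesis
        using insert.hyps by (simp add: \<nu>_def add_divide_distrib)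
    qed
    have "sum \<nu> (insert i I) = 1"
      using sum[of "\<lambda>_. 1"] \<mu>(2) s(1) by simp
    moreover have "\<forall>k\<in>insert i I. \<nu> k \<ge> 0"
      using \<mu>(1) s(1) by (auto simp: \<nu>_def)
    moreover have "\<forall>x\<in>C. (\<Sum>k\<in>insert i I. \<nu> k * g k x) \<ge> 0"
      using s by (simp add: sum)
    ultimately show ?thesis by blast
  qed
qed

section \<open>Convex lower semicontinuous functions\<close>

lemma lower_semicontinuous_on_add_continuous:
  assumes "lower_semicontinuous_on S g" "continuous_on S h"
  shows "lower_semicontinuous_on S (\<lambda>x. g x + h x)"
  unfolding lower_semicontinuous_on_def
proof (intro ballI allI impI)
  fix x c assume x: "x \<in> S" and c: "c < g x + h x"
  define e where "e = (g x + h x - c) / 2"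
  have "e > 0" using c by (simp add: e_def)
  then have "\<forall>\<^sub>F y in at x within S. g x - e < g y"
    using assms(1) x unfolding lower_semicontinuous_on_def by simp
  moreover have "\<forall>\<^sub>F y in at x within S. h x - e < h y"
    using assms(2) x \<open>e > 0\<close> by (intro order_tendstoD(1)[of h "h x"]) (auto simp: continuous_on)
  ultimately show "\<forall>\<^sub>F y in at x within S. c < g y + h y"
    by eventually_elim (simp add: e_def field_simps)
qed

lemma lower_semicontinuous_on_closed_sublevel:
  assumes "closed S" "lower_semicontinuous_on S g"
  shows "closed {x \<in> S. g x \<le> a}"
  unfolding closed_limpt
proof (intro allI impI)
  fix x assume x: "x islimpt {x \<in> S. g x \<le> a}"
  then have xS: "x \<in> S"
    using assms(1) unfolding closed_limpt by (metis (no_types, lifting) islimpt_subset mem_Collect_eq subsetI)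
  moreover have "g x \<le> a"
  proof (rule ccontr)
    assume "\<not> g x \<le> a"
    then have "\<forall>\<^sub>F y in at x within S. a < g y"
      using assms(2) xS unfolding lower_semicontinuous_on_def by simp
    then have "\<forall>\<^sub>F y in at x within {x \<in> S. g x \<le> a}. a < g y"
      by (rule filter_leD[OF at_le, rotated]) auto
    moreover have "\<forall>\<^sub>F y in at x within {x \<in> S. g x \<le> a}. y \<in> {x \<in> S. g x \<le> a}"
      by (simp add: eventually_at_filter)
    ultimately have "\<forall>\<^sub>F y in at x within {x \<in> S. g x \<le> a}. False"
      by eventually_elim simp
    with x show False by (simp add: trivial_limit_within eventually_False)
  qed
  ultimately show "x \<in> {x \<in> S. g x \<le> a}" by simp
qed

text \<open>Lower semicontinuity at \<open>v\<close> bounds \<open>g\<close> from below on a small ball, and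
  convexity along the ray from \<open>v\<close> propagates this bound with at most linear loss. This makes
  quadratic perturbations of \<open>g\<close> coercive.\<close>
lemma convex_lsc_linear_minorant:
  fixes g :: "'a::real_normed_vector \<Rightarrow> real"
  assumes g: "convex_on K g" "lower_semicontinuous_on K g" and v: "v \<in> K"
  obtains b where "b > 0" "\<And>u. u \<in> K \<Longrightarrow> g v - 1 - b * norm (u - v) \<le> g u"
proof -
  have "\<forall>\<^sub>F y in at v within K. g v - 1 < g y"
    using g(2) v unfolding lower_semicontinuous_on_def by simp
  then obtain d where d: "d > 0" "\<And>y. y \<in> K \<Longrightarrow> y \<noteq> v \<Longrightarrow> dist y v < d \<Longrightarrow> g v - 1 < g y"
    unfolding eventually_at by blast
  then have near: "g v - 1 < g y" if "y \<in> K" "norm (y - v) < d" for y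
    using that by (cases "y = v") (auto simp: dist_norm)
  have "g v - 1 - 2 / d * norm (u - v) \<le> g u" if u: "u \<in> K" for u
  proof (cases "norm (u - v) < d")
    case True
    then show ?thesis using near[OF u] d(1) by (smt (verit) divide_nonneg_nonneg mult_nonneg_nonneg norm_ge_zero)
  next
    case False
    \<comment> \<open>the point at parameter \<open>s\<close> on the segment is at distance \<open>d / 2\<close> from \<open>v\<close>\<close>
    define s where "s = d / (2 * norm (u - v))"
    have s: "0 < s" "s \<le> 1" "s * norm (u - v) = d / 2"
      using False d(1) unfolding s_def
      by (auto simp: field_simps simp del: zero_less_norm_iff intro: divide_pos_pos less_le_trans[of 0 d])
    have eq: "(1 - s) *\<^sub>R v + s *\<^sub>R u - v = s *\<^sub>R (u - v)" by (simp add: algebra_simps)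
    have "norm ((1 - s) *\<^sub>R v + s *\<^sub>R u - v) < d"
      unfolding eq using s d(1) by simp
    moreover have "(1 - s) *\<^sub>R v + s *\<^sub>R u \<in> K"
      using g(1) u v s by (auto simp: convex_on_def intro: convexD)
    ultimately have "g v - 1 < g ((1 - s) *\<^sub>R v + s *\<^sub>R u)" by (intro near)
    also have "\<dots> \<le> (1 - s) * g v + s * g u"
      using convex_onD[OF g(1), of s v u] u v s by simp
    finally have "s * (g v - g u) < 1" by (simp add: algebra_simps)
    then have "g v - g u < 1 / s" using s(1) by (simp add: field_simps)
    also have "1 / s = 2 / d * norm (u - v)" using False d(1) by (simp add: s_def)
    finally show ?thesis by simp
  qed
  with d(1) show ?thesis by (intro that[of "2 / d"]) auto
qed

lemma convex_on_norm_power2: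
  fixes v :: "'a::real_normed_vector"
  assumes "convex K" shows "convex_on K (\<lambda>u. (norm (u - v))\<^sup>2)"
proof (rule convex_onI[OF _ assms])
  fix t :: real and x y assume t: "0 < t" "t < 1"
  have eq: "(1 - t) *\<^sub>R x + t *\<^sub>R y - v = (1 - t) *\<^sub>R (x - v) + t *\<^sub>R (y - v)"
    by (simp add: algebra_simps)
  have "norm ((1 - t) *\<^sub>R x + t *\<^sub>R y - v) \<le> (1 - t) * norm (x - v) + t * norm (y - v)"
    unfolding eq using t by (intro norm_triangle_le) simp
  then have "(norm ((1 - t) *\<^sub>R x + t *\<^sub>R y - v))\<^sup>2 \<le> ((1 - t) * norm (x - v) + t * norm (y - v))\<^sup>2"
    by (intro power_mono) auto
  also have "\<dots> \<le> (1 - t) * (norm (x - v))\<^sup>2 + t * (norm (y - v))\<^sup>2"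
    using convex_onD[OF convex_power2, of t "norm (x - v)" "norm (y - v)"] t by simp
  finally show "(norm ((1 - t) *\<^sub>R x + t *\<^sub>R y - v))\<^sup>2 \<le> (1 - t) * (norm (x - v))\<^sup>2 + t * (norm (y - v))\<^sup>2" .
qed

section \<open>Strongly monotone equilibrium problems\<close>

text \<open>If no point of \<open>K\<close> worked for the finite set \<open>V\<close>, the alternative for convex functions would
  give weights \<open>\<mu>\<close> with \<open>\<Sum>v. \<mu> v * F v u \<ge> \<epsilon>\<close> on \<open>K\<close>. At the barycentre \<open>u\<close> of
  \<open>\<mu>\<close>, convexity bounds the left side by a double sum that is nonpositive by monotonicity. Thanks to
  monotonicity, this elementary argument takes the place of the Knaster-Kuratowski-Mazurkiewicz
  lemma.\<close>
lemma monotone_equilibrium_approximate: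
  fixes F :: "'a::real_vector \<Rightarrow> 'a \<Rightarrow> real"
  assumes K: "K \<noteq> {}"
    and mono: "\<And>u v. u \<in> K \<Longrightarrow> v \<in> K \<Longrightarrow> F u v + F v u \<le> 0"
    and conv: "\<And>v. v \<in> K \<Longrightarrow> convex_on K (F v)"
    and V: "finite V" "V \<subseteq> K" and \<epsilon>: "\<epsilon> > 0"
  obtains u where "u \<in> K" "\<And>v. v \<in> V \<Longrightarrow> F v u \<le> \<epsilon>"
proof (rule ccontr)
  assume "\<not> thesis"
  with that have neg: "\<exists>v\<in>V. F v u > \<epsilon>" if "u \<in> K" for u
    using \<open>u \<in> K\<close> by (meson not_le)
  have cK: "convex K" using K conv by (auto simp: convex_on_def)
  have "\<exists>\<mu>. (\<forall>v\<in>V. \<mu> v \<ge> 0) \<and> sum \<mu> V = 1 \<and> (\<forall>u\<in>K. (\<Sum>v\<in>V. \<mu> v * (F v u + - \<epsilon>)) \<ge> 0)"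
  proof (rule convex_alternative[OF V(1) _ K])
    show "convex_on K (\<lambda>u. F v u + - \<epsilon>)" if "v \<in> V" for v
      using that V(2) conv cK by (intro convex_on_add) (auto simp: convex_on_const)
    show "\<exists>v\<in>V. F v u + - \<epsilon> \<ge> 0" if "u \<in> K" for u
      using neg[OF that] by force
  qed
  then obtain \<mu> where \<mu>: "\<And>v. v \<in> V \<Longrightarrow> \<mu> v \<ge> 0" "sum \<mu> V = 1"
    "\<And>u. u \<in> K \<Longrightarrow> (\<Sum>v\<in>V. \<mu> v * (F v u + - \<epsilon>)) \<ge> 0" by blast
  define u where "u = (\<Sum>v\<in>V. \<mu> v *\<^sub>R v)"
  have Vne: "V \<noteq> {}" using \<mu>(2) by auto
  have uK: "u \<in> K" unfolding u_def using V \<mu> cK by (intro convex_sum) auto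
  have "\<epsilon> = (\<Sum>v\<in>V. \<mu> v * \<epsilon>)" using \<mu>(2) by (simp flip: sum_distrib_right)
  also have "\<dots> \<le> (\<Sum>v\<in>V. \<mu> v * F v u)"
    using \<mu>(3)[OF uK] by (simp add: algebra_simps sum_subtractf)
  also have "\<dots> \<le> (\<Sum>v\<in>V. \<mu> v * (\<Sum>w\<in>V. \<mu> w * F v w))"
    unfolding u_def using V Vne \<mu> conv
    by (intro sum_mono mult_left_mono convex_on_sum[where C = K]) auto
  also have "\<dots> = (\<Sum>v\<in>V. \<Sum>w\<in>V. \<mu> v * \<mu> w * F v w)"
    by (simp add: sum_distrib_left mult.assoc)
  finally have 1: "\<epsilon> \<le> (\<Sum>v\<in>V. \<Sum>w\<in>V. \<mu> v * \<mu> w * F v w)" .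
  also have "\<dots> = (\<Sum>v\<in>V. \<Sum>w\<in>V. \<mu> v * \<mu> w * F w v)"
    by (subst sum.swap) (simp add: mult_ac)
  finally have "2 * \<epsilon> \<le> (\<Sum>v\<in>V. \<Sum>w\<in>V. \<mu> v * \<mu> w * (F v w + F w v))"
    using 1 by (simp add: sum.distrib algebra_simps)
  also have "\<dots> \<le> 0"
    using V(2) by (intro sum_nonpos mult_nonneg_nonpos mono) (auto simp: \<mu>(1))
  finally show False using \<epsilon> by simp
qed

text \<open>Half of the strong monotonicity is moved into \<open>G v u = F v u + m / 2 * (norm (u - v))\<^sup>2\<close>, which
  is still monotone and still convex and lower semicontinuous in \<open>u\<close>, but now has bounded
  sublevel sets. These sets are closed and convex, any finitely many of them intersect by the
  approximate solvability, and reflexivity gives a common point.\<close>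
lemma strongly_monotone_equilibrium_minty:
  fixes F :: "'a::real_normed_vector \<Rightarrow> 'a \<Rightarrow> real"
  assumes refl: "reflexive TYPE('a)"
    and K: "closed K" "v0 \<in> K"
    and m: "m > 0" "\<And>u v. u \<in> K \<Longrightarrow> v \<in> K \<Longrightarrow> F u v + F v u \<le> - m * (norm (u - v))\<^sup>2"
    and conv: "\<And>v. v \<in> K \<Longrightarrow> convex_on K (F v)"
    and lsc: "\<And>v. v \<in> K \<Longrightarrow> lower_semicontinuous_on K (F v)"
  obtains u where "u \<in> K" "\<And>v. v \<in> K \<Longrightarrow> F v u \<le> 0"
proof -
  define G where "G v u = F v u + m / 2 * (norm (u - v))\<^sup>2" for u v
  have cK: "convex K" using K conv by (auto simp: convex_on_def)
  have G_mono: "G u v + G v u \<le> 0" if "u \<in> K" "v \<in> K" for u v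
    using m(2)[OF that] by (simp add: G_def norm_minus_commute)
  have G_conv: "convex_on K (G v)" if "v \<in> K" for v
    unfolding G_def using m(1) by (intro convex_on_add conv that convex_on_cmul convex_on_norm_power2 cK) auto
  have G_lsc: "lower_semicontinuous_on K (G v)" if "v \<in> K" for v
    unfolding G_def by (intro lower_semicontinuous_on_add_continuous lsc that continuous_intros)
  define C where "C p = {u \<in> K. G (fst p) u \<le> snd p}" for p :: "'a \<times> real"
  have "(\<Inter>p\<in>K \<times> {0<..}. C p) \<noteq> {}"
  proof (rule reflexive_closed_convex_fip[OF refl, where ?i0.0 = "(v0, 1)"])
    show "closed (C p)" if "p \<in> K \<times> {0<..}" for p
      unfolding C_def using that by (intro lower_semicontinuous_on_closed_sublevel K G_lsc) auto
    show "convex (C p)" if "p \<in> K \<times> {0<..}" for p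
      unfolding C_def using that by (intro convex_on_sublevel G_conv) auto
    show "(v0, 1::real) \<in> K \<times> {0<..}" using K by simp
    obtain b where b: "b > 0" "\<And>u. u \<in> K \<Longrightarrow> F v0 v0 - 1 - b * norm (u - v0) \<le> F v0 u"
      using convex_lsc_linear_minorant[OF conv lsc] K by blast
    define B where "B = \<bar>F v0 v0\<bar> + 2"
    have "norm (u - v0) \<le> max 1 (2 * (B + b) / m)" if u: "u \<in> C (v0, 1)" for u
    proof (cases "norm (u - v0) \<le> 1")
      case False
      let ?r = "norm (u - v0)"
      have "m / 2 * ?r\<^sup>2 \<le> B + b * ?r"
        using b(2)[of u] u unfolding C_def G_def B_def by auto
      also have "\<dots> \<le> (B + b) * ?r"
        using False by (simp add: B_def algebra_simps)
          (smt (verit) abs_ge_zero mult_left_mono mult_cancel_left1)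
      finally have "(m / 2 * ?r) * ?r \<le> (B + b) * ?r" by (simp add: power2_eq_square)
      moreover have "?r > 0" using False by linarith
      ultimately have "m / 2 * ?r \<le> B + b"
        by (rule mult_right_le_imp_le)
      then have "?r \<le> 2 * (B + b) / m" using m(1) by (simp add: field_simps)
      then show ?thesis by simp
    qed simp
    then show "bounded (C (v0, 1))"
      unfolding bounded_def by (metis dist_norm norm_minus_commute)
  next
    fix J assume J: "finite J" "J \<subseteq> K \<times> {0::real<..}"
    show "(\<Inter>p\<in>J. C p) \<noteq> {}"
    proof (cases "J = {}")
      case False
      define \<epsilon> where "\<epsilon> = Min (snd ` J)"
      have "\<epsilon> \<in> snd ` J" unfolding \<epsilon>_def using J False by (intro Min_in) auto
      then have "\<epsilon> > 0" using J by auto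
      have le: "\<epsilon> \<le> snd p" if "p \<in> J" for p unfolding \<epsilon>_def using J that by (intro Min_le) auto
      have "K \<noteq> {}" "finite (fst ` J)" "fst ` J \<subseteq> K"
        using K(2) J by auto
      then obtain u where "u \<in> K" "\<And>v. v \<in> fst ` J \<Longrightarrow> G v u \<le> \<epsilon>"
        using monotone_equilibrium_approximate[of K G "fst ` J" \<epsilon>, OF _ G_mono G_conv _ _ \<open>\<epsilon> > 0\<close>]
        by blast
      then have "u \<in> (\<Inter>p\<in>J. C p)"
        using le unfolding C_def by (auto intro: order_trans)
      then show ?thesis by blast
    qed simp
  qed
  then obtain u where u: "\<And>v \<epsilon>. v \<in> K \<Longrightarrow> \<epsilon> > 0 \<Longrightarrow> u \<in> K \<and> G v u \<le> \<epsilon>"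
    unfolding C_def by fastforce
  have "F v u \<le> 0" if "v \<in> K" for v
  proof -
    have "G v u \<le> 0" by (rule field_le_epsilon) (use u[OF that] in simp)
    moreover have "0 \<le> m / 2 * (norm (u - v))\<^sup>2" using m(1) by simp
    ultimately show ?thesis by (simp add: G_def)
  qed
  with u[OF K(2), of 1] show ?thesis by (intro that) auto
qed

section \<open>Calculus of the Clarke directional derivative\<close>

lemma clarke_deriv_less_eventually:
  assumes "locally_lipschitz j" "clarke_deriv j x v < c"
  shows "\<forall>\<^sub>F (y, l) in nhds x \<times>\<^sub>F at_right 0. (j (y + l *\<^sub>R v) - j y) / l < c"
proof -
  have "Limsup (nhds x \<times>\<^sub>F at_right 0) (\<lambda>(y, l). ereal ((j (y + l *\<^sub>R v) - j y) / l)) < ereal c"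
    using assms by (simp flip: ereal_clarke_deriv)
  from Limsup_lessD[OF this] show ?thesis
    by eventually_elim auto
qed

lemma clarke_deriv_le:
  assumes "locally_lipschitz j"
    and "\<forall>\<^sub>F (y, l) in nhds x \<times>\<^sub>F at_right 0. (j (y + l *\<^sub>R v) - j y) / l \<le> c"
  shows "clarke_deriv j x v \<le> c"
proof -
  have "Limsup (nhds x \<times>\<^sub>F at_right 0) (\<lambda>(y, l). ereal ((j (y + l *\<^sub>R v) - j y) / l)) \<le> ereal c"
    by (rule Limsup_bounded, use assms(2) in eventually_elim) auto
  then show ?thesis
    by (simp flip: ereal_clarke_deriv[OF assms(1)])
qed

lemma clarke_deriv_sublinear:
  fixes j :: "'a::real_normed_vector \<Rightarrow> real"
  assumes j: "locally_lipschitz j"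
  shows "sublinear (clarke_deriv j x)"
  unfolding sublinear_def
proof (intro conjI allI impI)
  fix v w
  let ?F = "nhds x \<times>\<^sub>F at_right (0::real)"
  have fst: "(fst \<longlongrightarrow> x) ?F" and snd: "filterlim snd (at_right 0) ?F"
    by (rule filterlim_fst filterlim_snd)+
  have snd0: "(snd \<longlongrightarrow> 0) ?F" using snd by (simp add: filterlim_at)
  \<comment> \<open>The base point may be shifted by \<open>l v\<close> because the upper limit runs over moving base points.\<close>
  have "((\<lambda>p. fst p + snd p *\<^sub>R v) \<longlongrightarrow> x + 0 *\<^sub>R v) ?F"
    by (intro tendsto_intros fst snd0)
  then have shift: "filterlim (\<lambda>p. (fst p + snd p *\<^sub>R v, snd p)) ?F ?F"
    using snd by (intro filterlim_Pair) auto
  show "clarke_deriv j x (v + w) \<le> clarke_deriv j x v + clarke_deriv j x w"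
  proof (rule field_le_epsilon)
    fix e :: real assume e: "e > 0"
    have 1: "\<forall>\<^sub>F (y, l) in ?F. (j (y + l *\<^sub>R v) - j y) / l < clarke_deriv j x v + e / 2"
      and 2: "\<forall>\<^sub>F (y, l) in ?F. (j (y + l *\<^sub>R w) - j y) / l < clarke_deriv j x w + e / 2"
      using e by (auto intro: clarke_deriv_less_eventually[OF j])
    have "\<forall>\<^sub>F (y, l) in ?F. (j (y + l *\<^sub>R v + l *\<^sub>R w) - j (y + l *\<^sub>R v)) / l < clarke_deriv j x w + e / 2"
      using eventually_compose_filterlim[OF 2 shift] by (simp add: case_prod_unfold)
    with 1 have "\<forall>\<^sub>F (y, l) in ?F. (j (y + l *\<^sub>R (v + w)) - j y) / l
        \<le> clarke_deriv j x v + clarke_deriv j x w + e"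
    proof eventually_elim
      case (elim p)
      then show ?case
        by (cases p) (simp add: scaleR_add_right add.assoc[symmetric] diff_divide_distrib)
    qed
    then show "clarke_deriv j x (v + w) \<le> clarke_deriv j x v + clarke_deriv j x w + e"
      by (rule clarke_deriv_le[OF j])
  qed
next
  fix t :: real and v assume t: "t > 0"
  let ?F = "nhds x \<times>\<^sub>F at_right (0::real)"
  have fst: "(fst \<longlongrightarrow> x) ?F" and snd: "filterlim snd (at_right 0) ?F"
    by (rule filterlim_fst filterlim_snd)+
  have "filterlim (\<lambda>p. t * snd p) (at_right 0) ?F"
  proof -
    have "((\<lambda>p. t * snd p) \<longlongrightarrow> t * 0) ?F"
      using snd by (intro tendsto_intros) (simp add: filterlim_at)
    moreover have "\<forall>\<^sub>F p in ?F. t * snd p > 0"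
      using snd t by (auto simp: filterlim_at elim: eventually_mono)
    ultimately show ?thesis
      unfolding filterlim_at by (auto elim: eventually_mono)
  qed
  then have scale: "filterlim (\<lambda>p. (fst p, t * snd p)) ?F ?F"
    using fst by (intro filterlim_Pair)
  show "clarke_deriv j x (t *\<^sub>R v) \<le> t * clarke_deriv j x v"
  proof (rule field_le_epsilon)
    fix e :: real assume e: "e > 0"
    have "\<forall>\<^sub>F (y, l) in ?F. (j (y + l *\<^sub>R v) - j y) / l < clarke_deriv j x v + e / t"
      using e t by (intro clarke_deriv_less_eventually[OF j]) simp
    from eventually_compose_filterlim[OF this scale]
    have "\<forall>\<^sub>F (y, l) in ?F. (j (y + l *\<^sub>R t *\<^sub>R v) - j y) / l \<le> t * clarke_deriv j x v + e"
    proof eventually_elim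
      case (elim p)
      then have "t * ((j (fst p + (t * snd p) *\<^sub>R v) - j (fst p)) / (t * snd p)) < t * (clarke_deriv j x v + e / t)"
        using t by (intro mult_strict_left_mono) auto
      moreover have "t * (d / (t * snd p)) = d / snd p" for d
        using t by simp
      ultimately show ?case
        using t by (simp add: case_prod_unfold distrib_left mult.commute[of t])
    qed
    then show "clarke_deriv j x (t *\<^sub>R v) \<le> t * clarke_deriv j x v + e"
      by (rule clarke_deriv_le[OF j])
  qed
qed

text \<open>The bound on the difference quotients holds for all base points in a neighbourhood of
  \<open>x\<close>, and therefore near every base point sufficiently close to \<open>x\<close>.\<close>
lemma clarke_deriv_upper_semicontinuous:
  assumes j: "locally_lipschitz j" and c: "clarke_deriv j x v < c"
  shows "\<forall>\<^sub>F y in nhds x. clarke_deriv j y v \<le> c"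
proof -
  obtain P Q where P: "eventually P (nhds x)" and Q: "eventually Q (at_right 0)"
    and PQ: "\<And>y l. P y \<Longrightarrow> Q l \<Longrightarrow> (j (y + l *\<^sub>R v) - j y) / l < c"
    using clarke_deriv_less_eventually[OF assms] unfolding eventually_prod_filter by auto
  from P have "\<forall>\<^sub>F y in nhds x. eventually P (nhds y)"
    by (simp add: eventually_eventually)
  then show ?thesis
  proof eventually_elim
    case (elim y)
    have "\<forall>\<^sub>F (z, l) in nhds y \<times>\<^sub>F at_right 0. (j (z + l *\<^sub>R v) - j z) / l \<le> c"
      unfolding eventually_prod_filter using elim Q PQ by (force intro: less_imp_le)
    then show ?case by (rule clarke_deriv_le[OF j])
  qed
qed

lemma clarke_deriv_bound:
  fixes j :: "'a::real_normed_vector \<Rightarrow> real"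
  assumes j: "locally_lipschitz j"
  obtains L where "L \<ge> 0" "\<And>v. clarke_deriv j x v \<le> L * norm v"
proof -
  obtain e L where e: "e > 0" and L: "L-lipschitz_on (ball x e) j"
    using j unfolding locally_lipschitz_def by blast
  let ?F = "nhds x \<times>\<^sub>F at_right (0::real)"
  have fst: "(fst \<longlongrightarrow> x) ?F" and snd: "filterlim snd (at_right 0) ?F"
    by (rule filterlim_fst filterlim_snd)+
  have snd0: "(snd \<longlongrightarrow> 0) ?F" using snd by (simp add: filterlim_at)
  have "clarke_deriv j x v \<le> L * norm v" for v
  proof (rule clarke_deriv_le[OF j])
    have "((\<lambda>p. fst p + snd p *\<^sub>R v) \<longlongrightarrow> x + 0 *\<^sub>R v) ?F"
      by (intro tendsto_intros fst snd0)
    then have "\<forall>\<^sub>F p in ?F. fst p + snd p *\<^sub>R v \<in> ball x e"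
      using e by (auto dest!: tendstoD simp: dist_commute)
    moreover have "\<forall>\<^sub>F p in ?F. fst p \<in> ball x e"
      using tendstoD[OF fst e] by (simp add: dist_commute)
    moreover have "\<forall>\<^sub>F p in ?F. snd p > 0"
      using snd by (auto simp: filterlim_at elim: eventually_mono)
    ultimately show "\<forall>\<^sub>F (y, l) in ?F. (j (y + l *\<^sub>R v) - j y) / l \<le> L * norm v"
    proof eventually_elim
      case (elim p)
      have "j (fst p + snd p *\<^sub>R v) - j (fst p) \<le> L * (snd p * norm v)"
        using lipschitz_onD[OF L elim(1,2)] elim(3) by (simp add: dist_norm)
      with elim(3) show ?case
        by (simp add: case_prod_unfold field_simps)
    qed
  qed
  with lipschitz_on_nonneg[OF L] show ?thesis by (rule that)
qed

lemma sublinear_bounded_continuous: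
  fixes p :: "'a::real_normed_vector \<Rightarrow> real"
  assumes p: "sublinear p" and L: "L \<ge> 0" "\<And>v. p v \<le> L * norm v"
  shows "continuous_on UNIV p"
proof -
  have "p v - p w \<le> L * dist v w" for v w
    using sublinear_add[OF p, of w "v - w"] L(2)[of "v - w"] by (simp add: dist_norm)
  then have *: "\<bar>p v - p w\<bar> \<le> L * dist v w" for v w
    by (metis abs_le_iff dist_commute minus_diff_eq)
  have "L-lipschitz_on UNIV p"
    using L(1) * by (intro lipschitz_onI) (auto simp: dist_real_def)
  then show ?thesis by (rule lipschitz_on_continuous_on)
qed

lemma sublinear_affine_convex_on:
  fixes p :: "'b::real_vector \<Rightarrow> real" and G :: "'a::real_vector \<Rightarrow> 'b"
  assumes p: "sublinear p" and "linear G" and "convex K"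
  shows "convex_on K (\<lambda>u. p (G u - a))"
proof (rule convex_onI[OF _ assms(3)])
  fix t :: real and x y assume t: "0 < t" "t < 1"
  have "G ((1 - t) *\<^sub>R x + t *\<^sub>R y) - a = (1 - t) *\<^sub>R (G x - a) + t *\<^sub>R (G y - a)"
    unfolding linear_add[OF assms(2)] linear_scale[OF assms(2)] by (simp add: algebra_simps)
  then show "p (G ((1 - t) *\<^sub>R x + t *\<^sub>R y) - a) \<le> (1 - t) * p (G x - a) + t * p (G y - a)"
    using sublinear_add[OF p, of "(1 - t) *\<^sub>R (G x - a)" "t *\<^sub>R (G y - a)"] t
    by (simp add: sublinear_scaleR[OF p])
qed

lemma sublinear_blinfun: "sublinear (blinfun_apply \<xi>)"
  by (simp add: sublinear_def blinfun.add_right blinfun.scaleR_right)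

section \<open>Stationary variational-hemivariational inequalities\<close>

text \<open>The inequality says \<open>F u v \<ge> 0\<close> for all \<open>v \<in> K\<close>, where \<open>F\<close> collects all terms,
  including the dependence of \<open>\<phi>\<close> on the solution. The smallness condition makes \<open>F\<close> strongly
  monotone, which gives uniqueness and a point \<open>u\<close> with \<open>F v u \<le> 0\<close> for all \<open>v\<close>. Minty's
  argument turns this into the claim: the inequality at \<open>u + t (v - u)\<close> is divided by \<open>t\<close>, and
  \<open>t\<close> tends to \<open>0\<close>.\<close>
lemma variational_hemivariational_inequality:
  fixes K :: "'x::real_normed_vector set"
    and G :: "'x \<Rightarrow>\<^sub>L 'z::real_normed_vector"
    and A :: "'x \<Rightarrow> 'x dual"
    and \<phi> :: "'x \<Rightarrow> 'x \<Rightarrow> real"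
  assumes refl: "reflexive TYPE('x)"
    and K: "closed K" "convex K" "K \<noteq> {}"
    and A: "continuous_on UNIV A" "\<And>u v. (A u - A v) (u - v) \<ge> m * (norm (u - v))\<^sup>2"
    and \<phi>_conv: "\<And>u. u \<in> K \<Longrightarrow> convex_on K (\<phi> u)"
    and \<phi>_lsc: "\<And>u. u \<in> K \<Longrightarrow> lower_semicontinuous_on K (\<phi> u)"
    and \<phi>_mono: "\<And>u\<^sub>1 u\<^sub>2 v\<^sub>1 v\<^sub>2. u\<^sub>1 \<in> K \<Longrightarrow> u\<^sub>2 \<in> K \<Longrightarrow> v\<^sub>1 \<in> K \<Longrightarrow> v\<^sub>2 \<in> K \<Longrightarrow>
        \<phi> u\<^sub>1 v\<^sub>2 - \<phi> u\<^sub>1 v\<^sub>1 + \<phi> u\<^sub>2 v\<^sub>1 - \<phi> u\<^sub>2 v\<^sub>2 \<le> \<alpha> * norm (u\<^sub>1 - u\<^sub>2) * norm (v\<^sub>1 - v\<^sub>2)"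
    and j: "locally_lipschitz j"
      "\<And>u v. clarke_deriv j (G u) (G v - G u) + clarke_deriv j (G v) (G u - G v) \<le> \<beta> * (norm (u - v))\<^sup>2"
    and small: "\<alpha> + \<beta> < m"
  shows "\<exists>!u. u \<in> K \<and> (\<forall>v\<in>K. A u (v - u) + \<phi> u v - \<phi> u u
           + clarke_deriv j (G u) (G v - G u) \<ge> blinfun_apply f (v - u))"
proof -
  define F where "F u v = (A u - f) (v - u) + \<phi> u v - \<phi> u u + clarke_deriv j (G u) (G v - G u)" for u v
  have F_mono: "F u v + F v u \<le> - (m - \<alpha> - \<beta>) * (norm (u - v))\<^sup>2" if "u \<in> K" "v \<in> K" for u v
  proof -
    have "(A u - f) (v - u) + (A v - f) (u - v) = - ((A u - A v) (u - v))"
      by (simp add: blinfun.diff_left blinfun.diff_right)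
    moreover have "\<phi> u v - \<phi> u u + \<phi> v u - \<phi> v v \<le> \<alpha> * (norm (u - v))\<^sup>2"
      using \<phi>_mono[OF that that] by (simp add: power2_eq_square)
    ultimately show ?thesis
      using A(2)[of u v] j(2)[of u v] unfolding F_def by (simp add: algebra_simps)
  qed
  have F_conv: "convex_on K (F u)" if "u \<in> K" for u
  proof -
    have "convex_on K (\<lambda>v. (A u - f) (v - u))"
      by (intro sublinear_affine_convex_on sublinear_blinfun K(2) linear_id[unfolded id_def])
    moreover have "convex_on K (\<lambda>v. clarke_deriv j (G u) (G v - G u))"
      by (intro sublinear_affine_convex_on clarke_deriv_sublinear j K(2)
          bounded_linear.linear[OF blinfun.bounded_linear_right])
    moreover have "convex_on K (\<lambda>v. - \<phi> u u)"
      using K(2) by (simp add: convex_on_const)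
    ultimately have "convex_on K (\<lambda>v. (A u - f) (v - u) + \<phi> u v + - \<phi> u u + clarke_deriv j (G u) (G v - G u))"
      using \<phi>_conv[OF that] by (intro convex_on_add)
    then show ?thesis by (simp add: F_def[abs_def])
  qed
  have F_lsc: "lower_semicontinuous_on K (F u)" if "u \<in> K" for u
  proof -
    obtain L where L: "L \<ge> 0" "\<And>v. clarke_deriv j (G u) v \<le> L * norm v"
      using clarke_deriv_bound[OF j(1)] by blast
    have "continuous_on K (\<lambda>v. clarke_deriv j (G u) (G v - G u))"
      by (rule continuous_on_compose2[OF sublinear_bounded_continuous[OF clarke_deriv_sublinear[OF j(1)] L]])
        (auto intro!: continuous_intros)
    then have "lower_semicontinuous_on K (\<lambda>v. \<phi> u v +
        ((A u - f) (v - u) - \<phi> u u + clarke_deriv j (G u) (G v - G u)))"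
      by (intro lower_semicontinuous_on_add_continuous \<phi>_lsc that continuous_intros)
    then show ?thesis by (simp add: F_def[abs_def] algebra_simps)
  qed
  have F_eq: "F u v \<ge> 0 \<longleftrightarrow> A u (v - u) + \<phi> u v - \<phi> u u + clarke_deriv j (G u) (G v - G u) \<ge> f (v - u)" for u v
    by (auto simp: F_def blinfun.diff_left)
  obtain v0 where v0: "v0 \<in> K" using K(3) by blast
  obtain u where u: "u \<in> K" "\<And>v. v \<in> K \<Longrightarrow> F v u \<le> 0"
    using strongly_monotone_equilibrium_minty[OF refl K(1) v0 _ F_mono F_conv F_lsc] small by auto
  have "F u v \<ge> 0" if v: "v \<in> K" for v
  proof -
    define w where "w = v - u"
    have Gw: "G v - G u = G w" by (simp add: w_def blinfun.diff_right)
    have segment: "(A (u + t *\<^sub>R w) - f) w + \<phi> u v - \<phi> u u + clarke_deriv j (G (u + t *\<^sub>R w)) (G w)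
        + \<alpha> * t * (norm w)\<^sup>2 \<ge> 0" if t: "0 < t" "t \<le> 1" for t
    proof -
      define a where "a = u + t *\<^sub>R w"
      have a: "a = (1 - t) *\<^sub>R u + t *\<^sub>R v" by (simp add: a_def w_def algebra_simps)
      then have aK: "a \<in> K" using K(2) u(1) v t by (auto intro: convexD)
      have ua: "u - a = (- t) *\<^sub>R w" by (simp add: a_def)
      (* Comparing phi a with phi u costs only a term of order t^2, so that after division by t
         just the convexity of phi u matters. *)
      have "\<phi> a a - \<phi> a u + \<phi> u u - \<phi> u a \<le> \<alpha> * norm (a - u) * norm (u - a)"
        by (rule \<phi>_mono[OF aK u(1) u(1) aK])
      also have "\<dots> = \<alpha> * t\<^sup>2 * (norm w)\<^sup>2"
        using t by (simp add: a_def power2_eq_square)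
      finally have 1: "\<phi> a a - \<phi> a u + \<phi> u u - \<phi> u a \<le> \<alpha> * t\<^sup>2 * (norm w)\<^sup>2" .
      have 2: "\<phi> u a \<le> (1 - t) * \<phi> u u + t * \<phi> u v"
        unfolding a using convex_onD[OF \<phi>_conv[OF u(1)], of t u v] u(1) v t by simp
      have sub: "sublinear (clarke_deriv j (G a))" by (rule clarke_deriv_sublinear[OF j(1)])
      have "0 \<le> clarke_deriv j (G a) (G u - G a) + clarke_deriv j (G a) (t *\<^sub>R G w)"
        using sublinear_add[OF sub, of "G u - G a" "t *\<^sub>R G w"] sublinear_zero[OF sub]
        by (simp add: a_def blinfun.add_right blinfun.scaleR_right)
      then have 3: "0 \<le> clarke_deriv j (G a) (G u - G a) + t * clarke_deriv j (G a) (G w)"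
        using t by (simp add: sublinear_scaleR[OF sub])
      have "(A a - f) (u - a) = - t * (A a - f) w"
        unfolding ua by (simp only: blinfun.scaleR_right real_scaleR_def)
      with u(2)[OF aK] have "- t * (A a - f) w + \<phi> a u - \<phi> a a + clarke_deriv j (G a) (G u - G a) \<le> 0"
        by (simp only: F_def)
      with 1 2 3 have "0 \<le> t * ((A a - f) w + \<phi> u v - \<phi> u u + clarke_deriv j (G a) (G w) + \<alpha> * t * (norm w)\<^sup>2)"
        by (simp add: algebra_simps power2_eq_square)
      then show ?thesis
        using t unfolding a_def[symmetric] by (simp add: zero_le_mult_iff)
    qed
    have path: "((\<lambda>t. u + t *\<^sub>R w) \<longlongrightarrow> u) (at_right 0)"
      by (auto intro!: tendsto_eq_intros)
    have "(A \<longlongrightarrow> A u) (nhds u)"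
      using A(1) by (simp add: continuous_on_eq_continuous_at tendsto_at_iff_tendsto_nhds isCont_def)
    then have "((\<lambda>t. A (u + t *\<^sub>R w)) \<longlongrightarrow> A u) (at_right 0)"
      using path by (rule filterlim_compose)
    then have lim_A: "((\<lambda>t. (A (u + t *\<^sub>R w) - f) w) \<longlongrightarrow> (A u - f) w) (at_right 0)"
      by (intro tendsto_intros)
    have lim_t: "((\<lambda>t. \<alpha> * t * (norm w)\<^sup>2) \<longlongrightarrow> 0) (at_right 0)"
      by (auto intro!: tendsto_eq_intros)
    have path': "((\<lambda>t. G (u + t *\<^sub>R w)) \<longlongrightarrow> G u) (at_right 0)"
      by (intro tendsto_intros path)
    have "0 \<le> F u v + e" if e: "e > 0" for e
    proof -
      have "\<forall>\<^sub>F t in at_right 0. clarke_deriv j (G (u + t *\<^sub>R w)) (G w) \<le> clarke_deriv j (G u) (G w) + e / 3"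
        using clarke_deriv_upper_semicontinuous[OF j(1)] path' e
        by (intro eventually_compose_filterlim[OF _ path']) auto
      moreover have "\<forall>\<^sub>F t in at_right 0. (A (u + t *\<^sub>R w) - f) w < (A u - f) w + e / 3"
        by (rule order_tendstoD(2)[OF lim_A]) (use e in simp)
      moreover have "\<forall>\<^sub>F t in at_right 0. \<alpha> * t * (norm w)\<^sup>2 < e / 3"
        by (rule order_tendstoD(2)[OF lim_t]) (use e in simp)
      moreover have "\<forall>\<^sub>F t in at_right 0. 0 < t \<and> t \<le> (1::real)"
        unfolding eventually_at_right_field by (intro exI[of _ 1]) auto
      ultimately have "\<forall>\<^sub>F t in at_right (0::real). 0 \<le> F u v + e"
      proof eventually_elim
        case (elim t)
        then show ?case using segment[of t] unfolding F_def Gw w_def[symmetric] by simp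
      qed
      then show ?thesis by simp
    qed
    then show ?thesis by (rule field_le_epsilon)
  qed
  moreover have "u' = u''" if "u' \<in> K" "u'' \<in> K" "F u' u'' \<ge> 0" "F u'' u' \<ge> 0" for u' u''
  proof -
    have "(m - \<alpha> - \<beta>) * (norm (u' - u''))\<^sup>2 \<le> 0"
      using F_mono[OF that(1,2)] that(3,4) by (simp only: mult_minus_left)
    then have "(norm (u' - u''))\<^sup>2 \<le> 0"
      using small by (simp add: mult_le_0_iff)
    then show ?thesis by simp
  qed
  ultimately show ?thesis
    using u(1) unfolding F_eq by blast
qed

section \<open>Time stepping\<close>

text \<open>A condition on the \<open>n\<close>-th value that depends only on earlier values can be solved by
  well-founded recursion. Extensionality fixes the values beyond \<open>N\<close>.\<close>
lemma causal_unique_choice: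
  fixes P :: "(nat \<Rightarrow> 'a) \<Rightarrow> nat \<Rightarrow> 'a \<Rightarrow> bool"
  assumes causal: "\<And>g h n x. (\<And>i. i < n \<Longrightarrow> g i = h i) \<Longrightarrow> P g n x = P h n x"
    and ex1: "\<And>g n. \<exists>!x. P g n x"
  shows "\<exists>!u. u \<in> extensional {0..N} \<and> (\<forall>n\<le>N. P u n (u n))"
proof -
  have "\<exists>f. \<forall>n. P f n (f n)"
  proof (rule dependent_wf_choice[OF wf_less_than])
    show "P g n x = P h n x" if "\<And>i. (i, n) \<in> less_than \<Longrightarrow> g i = h i" for g h n x
      using that by (intro causal) simp
    show "\<exists>x. P g n x" for g n using ex1 by blast
  qed
  then obtain f where f: "\<And>n. P f n (f n)" by blast
  show ?thesis
  proof (rule ex1I[of _ "restrict f {0..N}"])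
    show "restrict f {0..N} \<in> extensional {0..N} \<and> (\<forall>n\<le>N. P (restrict f {0..N}) n (restrict f {0..N} n))"
      using f causal[of _ "restrict f {0..N}" f] by auto
  next
    fix u assume u: "u \<in> extensional {0..N} \<and> (\<forall>n\<le>N. P u n (u n))"
    have "u n = f n" if "n \<le> N" for n
      using that
    proof (induction n rule: less_induct)
      case (less n)
      then have "P u n (f n)" using f[of n] causal[of n u f] by auto
      with u less.prems ex1[of u n] show ?case by blast
    qed
    with u show "u = restrict f {0..N}"
      by (intro extensionalityI[of _ "{0..N}"]) auto
  qed
qed

lemma discrete_hist_causal:
  assumes "\<And>i. i < n \<Longrightarrow> v i = w i"
  shows "discrete_hist R q a k n v = discrete_hist R q a k n w"
proof (cases "n = 0")
  case False
  with assms have "(\<Sum>i = 1..n - 1. q (real n * k) (real i * k) (v i))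
      = (\<Sum>i = 1..n - 1. q (real n * k) (real i * k) (w i))"
    by (intro sum.cong) auto
  with False assms show ?thesis by (simp add: discrete_hist_def)
qed (simp add: discrete_hist_def)

theorem theorem14:
  fixes K :: "'x::banach set"
    and \<gamma>\<^sub>j :: "'x \<Rightarrow>\<^sub>L 'z::banach"
    and A :: "'x \<Rightarrow> 'x dual"
    and \<phi> :: "'y::real_normed_vector \<Rightarrow> 'x \<Rightarrow> 'x \<Rightarrow> real"
    and j :: "'z \<Rightarrow> real"
    and f :: "real \<Rightarrow> 'x dual"
    and R :: "'x \<Rightarrow>\<^sub>L 'y"
    and q :: "real \<Rightarrow> real \<Rightarrow> 'x \<Rightarrow>\<^sub>L 'x"
    and a\<^sub>S :: 'x
    and c\<^sub>j L\<^sub>A m\<^sub>A \<alpha>\<^sub>\<phi> \<beta>\<^sub>\<phi> c\<^sub>0 c\<^sub>1 \<alpha>\<^sub>j T k :: real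
    and N :: nat
  assumes "reflexive TYPE('x)"
    and "closed K" and "convex K" and "0 \<in> K"
    and "c\<^sub>j > 0" and "\<And>v. norm (\<gamma>\<^sub>j v) \<le> c\<^sub>j * norm v"
    and "L\<^sub>A > 0" and "L\<^sub>A-lipschitz_on UNIV A"
    and "m\<^sub>A > 0" and "\<And>v\<^sub>1 v\<^sub>2. (A v\<^sub>1 - A v\<^sub>2) (v\<^sub>1 - v\<^sub>2) \<ge> m\<^sub>A * (norm (v\<^sub>1 - v\<^sub>2))\<^sup>2"
    and "\<And>y u. u \<in> K \<Longrightarrow> convex_on K (\<phi> y u)"
    and "\<And>y u. u \<in> K \<Longrightarrow> lower_semicontinuous_on K (\<phi> y u)"
    and "\<alpha>\<^sub>\<phi> > 0" and "\<beta>\<^sub>\<phi> > 0"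
    and "\<And>y\<^sub>1 y\<^sub>2 u\<^sub>1 u\<^sub>2 v\<^sub>1 v\<^sub>2. u\<^sub>1 \<in> K \<Longrightarrow> u\<^sub>2 \<in> K \<Longrightarrow> v\<^sub>1 \<in> K \<Longrightarrow> v\<^sub>2 \<in> K \<Longrightarrow>
           \<phi> y\<^sub>1 u\<^sub>1 v\<^sub>2 - \<phi> y\<^sub>1 u\<^sub>1 v\<^sub>1 + \<phi> y\<^sub>2 u\<^sub>2 v\<^sub>1 - \<phi> y\<^sub>2 u\<^sub>2 v\<^sub>2
             \<le> \<alpha>\<^sub>\<phi> * norm (u\<^sub>1 - u\<^sub>2) * norm (v\<^sub>1 - v\<^sub>2) + \<beta>\<^sub>\<phi> * norm (y\<^sub>1 - y\<^sub>2) * norm (v\<^sub>1 - v\<^sub>2)"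
    and "locally_lipschitz j"
    and "c\<^sub>0 \<ge> 0" and "c\<^sub>1 \<ge> 0"
    and "\<And>z \<xi>. \<xi> \<in> clarke_subdiff j z \<Longrightarrow> norm \<xi> \<le> c\<^sub>0 + c\<^sub>1 * norm z"
    and "\<alpha>\<^sub>j > 0"
    and "\<And>z\<^sub>1 z\<^sub>2. clarke_deriv j z\<^sub>1 (z\<^sub>2 - z\<^sub>1) + clarke_deriv j z\<^sub>2 (z\<^sub>1 - z\<^sub>2)
                    \<le> \<alpha>\<^sub>j * (norm (z\<^sub>1 - z\<^sub>2))\<^sup>2"
    and "continuous_on {0..} f"
    and "continuous_on ({0..} \<times> {0..}) (\<lambda>(t, s). q t s)"
    and "\<alpha>\<^sub>\<phi> + \<alpha>\<^sub>j * c\<^sub>j\<^sup>2 < m\<^sub>A"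
    and "T > 0" and "N > 0" and "k = T / real N"
  shows "\<exists>!u. u \<in> {0..N} \<rightarrow>\<^sub>E K \<and>
    (\<forall>n\<le>N. \<forall>v\<in>K.
       A (u n) (v - u n)
         + \<phi> (discrete_hist R q a\<^sub>S k n u) (u n) v
         - \<phi> (discrete_hist R q a\<^sub>S k n u) (u n) (u n)
         + clarke_deriv j (\<gamma>\<^sub>j (u n)) (\<gamma>\<^sub>j v - \<gamma>\<^sub>j (u n))
       \<ge> f (real n * k) (v - u n))"
proof -
  (* P g n x says that x solves the inequality at time level n with the history of g. *)
  define P where "P g n x \<longleftrightarrow> x \<in> K \<and> (\<forall>v\<in>K.
       A x (v - x) + \<phi> (discrete_hist R q a\<^sub>S k n g) x v - \<phi> (discrete_hist R q a\<^sub>S k n g) x x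
         + clarke_deriv j (\<gamma>\<^sub>j x) (\<gamma>\<^sub>j v - \<gamma>\<^sub>j x) \<ge> f (real n * k) (v - x))" for g n x
  have "\<exists>!u. u \<in> extensional {0..N} \<and> (\<forall>n\<le>N. P u n (u n))"
  proof (rule causal_unique_choice)
    show "P g n x = P h n x" if "\<And>i. i < n \<Longrightarrow> g i = h i" for g h n x
    proof -
      have "discrete_hist R q a\<^sub>S k n g = discrete_hist R q a\<^sub>S k n h"
        by (rule discrete_hist_causal) (rule that)
      then show ?thesis by (simp only: P_def)
    qed
    show "\<exists>!x. P g n x" for g n
      unfolding P_def
    proof (rule variational_hemivariational_inequality)
      show "continuous_on UNIV A"
        using assms(8) by (rule lipschitz_on_continuous_on)
      show "K \<noteq> {}" using assms(4) by blast
      show "clarke_deriv j (\<gamma>\<^sub>j u) (\<gamma>\<^sub>j v - \<gamma>\<^sub>j u) + clarke_deriv j (\<gamma>\<^sub>j v) (\<gamma>\<^sub>j u - \<gamma>\<^sub>j v)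
          \<le> (\<alpha>\<^sub>j * c\<^sub>j\<^sup>2) * (norm (u - v))\<^sup>2" for u v
      proof -
        have "(norm (\<gamma>\<^sub>j u - \<gamma>\<^sub>j v))\<^sup>2 \<le> (c\<^sub>j * norm (u - v))\<^sup>2"
          using assms(6)[of "u - v"] by (intro power_mono) (simp_all add: blinfun.diff_right)
        then have "\<alpha>\<^sub>j * (norm (\<gamma>\<^sub>j u - \<gamma>\<^sub>j v))\<^sup>2 \<le> \<alpha>\<^sub>j * (c\<^sub>j * norm (u - v))\<^sup>2"
          using assms(20) by (intro mult_left_mono) auto
        with assms(21)[of "\<gamma>\<^sub>j u" "\<gamma>\<^sub>j v"] show ?thesis
          by (simp add: power_mult_distrib mult.assoc)
      qed
      show "\<phi> y u\<^sub>1 v\<^sub>2 - \<phi> y u\<^sub>1 v\<^sub>1 + \<phi> y u\<^sub>2 v\<^sub>1 - \<phi> y u\<^sub>2 v\<^sub>2 \<le> \<alpha>\<^sub>\<phi> * norm (u\<^sub>1 - u\<^sub>2) * norm (v\<^sub>1 - v\<^sub>2)"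
        if "u\<^sub>1 \<in> K" "u\<^sub>2 \<in> K" "v\<^sub>1 \<in> K" "v\<^sub>2 \<in> K" for y u\<^sub>1 u\<^sub>2 v\<^sub>1 v\<^sub>2
        using assms(15)[OF that, of y y] by simp
    qed (fact assms)+
  qed
  moreover have "u \<in> {0..N} \<rightarrow>\<^sub>E K \<and> (\<forall>n\<le>N. \<forall>v\<in>K.
       A (u n) (v - u n)
         + \<phi> (discrete_hist R q a\<^sub>S k n u) (u n) v
         - \<phi> (discrete_hist R q a\<^sub>S k n u) (u n) (u n)
         + clarke_deriv j (\<gamma>\<^sub>j (u n)) (\<gamma>\<^sub>j v - \<gamma>\<^sub>j (u n))
       \<ge> f (real n * k) (v - u n)) \<longleftrightarrow> u \<in> extensional {0..N} \<and> (\<forall>n\<le>N. P u n (u n))" for u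
    unfolding P_def PiE_def by (auto simp: Pi_iff)
  ultimately show ?thesis by simp
qed

end
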